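(* Let $\mathcal{D}\subset\mathbb{R}^n$ be open and let $F:\mathcal{D}\to\mathbb{R}^m$ be a smooth map satisfying the minimal graph system (i.e. the graph of $F$ is a minimal submanifold of $\mathbb{R}^{n}\times\mathbb{R}^m$). Let $p=(x,y)\in\mathcal{D}\times\mathbb{R}^m$, and let $\lambda_1,\ldots,\lambda_r>0$ be the nonzero singular values of $\mathrm{d}F|_x$, where $r=\operatorname{rank}\mathrm{d}F|_x$. Then the form $\Theta(F)|_p$ has comass $\|\Theta(F)|_p\|=1$ if and only if $$\mathcal{S}(\lambda):=\sum_{i=1}^{r}\frac{\lambda_i^2}{1+\lambda_i^2}\leq 1.$$
   Context: Comass: for an $n$-form $\omega$ on a Euclidean space, $\|\omega\|=\sup\{|\omega(\xi)|:\xi\text{ is a unit simple }n\text{-vector}\}$. Minimal graph system: $F$ satisfies the minimal graph system if its graph $\{(x,F(x)):x\in\mathcal{D}\}\subset\mathbb{R}^n\times\mathbb{R}^m$ has vanishing mean curvature vector. The Tsai–Wang form $\Theta(F)$: this is an $n$-form on $\mathcal{D}\times\mathbb{R}^m$. Its value at $p=(x,y)$ depends only on $\mathrm{d}F|_x$ and is given as follows. Choose oriented orthonormal linear coordinates $x_1,\ldots,x_n$ on $\mathbb{R}^n$ and orthonormal linear coordinates $y_1,\ldots,y_m$ on $\mathbb{R}^m$ (no orientation prescribed) adapted to the singular value decomposition of $\mathrm{d}F|_x$: $\mathrm{d}F|_x(\partial/\partial x_i)=\lambda_i\,\partial/\partial y_i$ for $1\le i\le r$ and $\mathrm{d}F|_x(\partial/\partial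 x_i)=0$ for $i>r$, with $\lambda_1,\ldots,\lambda_r>0$. Put $\widehat{\mathrm{d}x_i}=\mathrm{d}x_1\wedge\cdots\wedge\mathrm{d}x_{i-1}\wedge\mathrm{d}x_{i+1}\wedge\cdots\wedge\mathrm{d}x_n$ and $\mathcal{C}(\lambda)=\sqrt{\prod_{i=1}^r(1+\lambda_i^2)}$, $\mathcal{S}(\lambda)=\sum_{i=1}^r\frac{\lambda_i^2}{1+\lambda_i^2}$. Then $$\Theta(F)|_p=\mathcal{C}(\lambda)\Bigl((1-\mathcal{S}(\lambda))\,\mathrm{d}x_1\wedge\cdots\wedge\mathrm{d}x_n+\sum_{i=1}^{r}(-1)^{i-1}\frac{\lambda_i}{1+\lambda_i^2}\,\mathrm{d}y_i\wedge\widehat{\mathrm{d}x_i}\Bigr).$$ *)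

theory Defs
  imports "HOL-Analysis.Analysis"
begin

section \<open>Exterior forms and comass\<close>

text \<open>An \<open>n\<close>-form on \<open>'v\<close> is represented by its values on lists of \<open>n\<close> vectors.
  The wedge product of 1-forms carries no factor \<open>1/n!\<close>:
  \<open>(\<alpha>\<^sub>1 \<and> \<dots> \<and> \<alpha>\<^sub>n)(v\<^sub>1,\<dots>,v\<^sub>n) = det (\<alpha>\<^sub>i(v\<^sub>j))\<close>.\<close>

definition wedge :: "('v \<Rightarrow> real) list \<Rightarrow> 'v list \<Rightarrow> real" where
  "wedge \<alpha>s vs =
     (\<Sum>\<sigma> | \<sigma> permutes {..<length \<alpha>s}.
        of_int (sign \<sigma>) * (\<Prod>k<length \<alpha>s. (\<alpha>s ! k) (vs ! \<sigma> k)))"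

text \<open>The Euclidean norm of the simple \<open>n\<close>-vector \<open>v\<^sub>1 \<and> \<dots> \<and> v\<^sub>n\<close>:
  its square is the Gram determinant \<open>det (v\<^sub>i \<bullet> v\<^sub>j)\<close>.\<close>

definition simple_vector_norm :: "'v::real_inner list \<Rightarrow> real" where
  "simple_vector_norm vs = sqrt (wedge (map (\<bullet>) vs) vs)"

text \<open>A simple \<open>n\<close>-vector \<open>\<xi> = v\<^sub>1 \<and> \<dots> \<and> v\<^sub>n\<close> is represented by its list of factors, and
  \<open>\<omega>(\<xi>) = \<omega>(v\<^sub>1,\<dots>,v\<^sub>n)\<close>; for an alternating \<open>\<omega>\<close> this depends on \<open>\<xi>\<close> only.\<close>

definition comass :: "nat \<Rightarrow> ('v::real_inner list \<Rightarrow> real) \<Rightarrow> real" where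
  "comass n \<omega> = Sup {\<bar>\<omega> vs\<bar> |vs. length vs = n \<and> simple_vector_norm vs = 1}"


section \<open>Smooth maps and the minimal graph system\<close>

text \<open>For open \<open>D\<close> and finite-dimensional domain this is the class \<open>C\<^sup>k\<close>.\<close>

primrec Ck_on :: "nat \<Rightarrow> ('a::real_normed_vector \<Rightarrow> 'b::real_normed_vector) \<Rightarrow> 'a set \<Rightarrow> bool" where
  "Ck_on 0 F D \<longleftrightarrow> continuous_on D F"
| "Ck_on (Suc k) F D \<longleftrightarrow>
     (\<forall>x\<in>D. F differentiable (at x)) \<and>
     (\<forall>v. Ck_on k (\<lambda>x. frechet_derivative F (at x) v) D)"

definition smooth_on :: "'a set \<Rightarrow> ('a::real_normed_vector \<Rightarrow> 'b::real_normed_vector) \<Rightarrow> bool" where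
  "smooth_on D F \<longleftrightarrow> (\<forall>k. Ck_on k F D)"

definition normal_part :: "'v::euclidean_space set \<Rightarrow> 'v \<Rightarrow> 'v" where
  "normal_part T v = (THE w. (\<forall>t\<in>T. orthogonal w t) \<and> v - w \<in> T)"

definition partial_deriv :: "'n \<Rightarrow> (real^'n \<Rightarrow> 'v::real_normed_vector) \<Rightarrow> real^'n \<Rightarrow> 'v" where
  "partial_deriv a X x = frechet_derivative X (at x) (axis a 1)"

definition induced_metric :: "(real^'n \<Rightarrow> 'v::euclidean_space) \<Rightarrow> real^'n \<Rightarrow> real^'n^'n" where
  "induced_metric X x = (\<chi> a b. partial_deriv a X x \<bullet> partial_deriv b X x)"

text \<open>The second fundamental form of an immersed submanifold of Euclidean space, on coordinate
  vector fields: \<open>A(\<partial>\<^sub>a, \<partial>\<^sub>b) = (\<partial>\<^sub>a \<partial>\<^sub>b X)\<^sup>\<bottom>\<close>.\<close>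

definition second_fundamental_form ::
    "(real^'n \<Rightarrow> 'v::euclidean_space) \<Rightarrow> real^'n \<Rightarrow> 'n \<Rightarrow> 'n \<Rightarrow> 'v" where
  "second_fundamental_form X x a b =
     normal_part (range (frechet_derivative X (at x))) (partial_deriv a (partial_deriv b X) x)"

text \<open>The mean curvature vector of the immersion \<open>X\<close>, i.e. the trace of the second fundamental
  form with respect to the induced metric, \<open>g\<^sup>a\<^sup>b A(\<partial>\<^sub>a, \<partial>\<^sub>b)\<close>.\<close>

definition mean_curvature_vector ::
    "(real^'n \<Rightarrow> 'v::euclidean_space) \<Rightarrow> real^'n \<Rightarrow> 'v" where
  "mean_curvature_vector X x =
     (\<Sum>a\<in>UNIV. \<Sum>b\<in>UNIV.
        (matrix_inv (induced_metric X x) $ a $ b) *\<^sub>R second_fundamental_form X x a b)"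

definition minimal_graph_system :: "(real^'n) set \<Rightarrow> (real^'n \<Rightarrow> real^'m) \<Rightarrow> bool" where
  "minimal_graph_system D F \<longleftrightarrow>
     (\<forall>x\<in>D. mean_curvature_vector (\<lambda>z. (z, F z)) x = 0)"


section \<open>Singular value decomposition and the Tsai--Wang form\<close>

definition orthonormal_family :: "nat \<Rightarrow> (nat \<Rightarrow> 'v::real_inner) \<Rightarrow> bool" where
  "orthonormal_family k e \<longleftrightarrow>
     (\<forall>i\<in>{1..k}. \<forall>j\<in>{1..k}. e i \<bullet> e j = (if i = j then 1 else 0))"

text \<open>Here \<open>e 1, \<dots>, e n\<close> and \<open>f 1, \<dots>, f m\<close> play the roles of \<open>\<partial>/\<partial>x\<^sub>i\<close> and \<open>\<partial>/\<partial>y\<^sub>j\<close>.\<close>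

definition is_svd ::
    "(real^'n \<Rightarrow> real^'m) \<Rightarrow> (nat \<Rightarrow> real^'n) \<Rightarrow> (nat \<Rightarrow> real^'m) \<Rightarrow> nat \<Rightarrow> (nat \<Rightarrow> real) \<Rightarrow> bool" where
  "is_svd L e f r lam \<longleftrightarrow>
     orthonormal_family CARD('n) e \<and> orthonormal_family CARD('m) f \<and>
     r \<le> CARD('n) \<and> r \<le> CARD('m) \<and>
     (\<forall>i\<in>{1..r}. lam i > 0 \<and> L (e i) = lam i *\<^sub>R f i) \<and>
     (\<forall>i\<in>{r<..CARD('n)}. L (e i) = 0)"

text \<open>\<open>lam 1, \<dots>, lam r\<close> are the nonzero singular values of \<open>L\<close>, listed with multiplicity.\<close>

definition nonzero_singular_values ::
    "(real^'n \<Rightarrow> real^'m) \<Rightarrow> nat \<Rightarrow> (nat \<Rightarrow> real) \<Rightarrow> bool" where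
  "nonzero_singular_values L r lam \<longleftrightarrow> (\<exists>e f. is_svd L e f r lam)"

text \<open>The index type \<open>'n\<close> of \<open>real^'n\<close> is unordered, so the standard orientation depends on an
  enumeration \<open>\<nu>\<close> of \<open>'n\<close> by \<open>{1..n}\<close>: the basis \<open>axis (\<nu> 1) 1, \<dots>, axis (\<nu> n) 1\<close> is positive.\<close>

definition positively_oriented :: "(nat \<Rightarrow> 'n::finite) \<Rightarrow> (nat \<Rightarrow> real^'n) \<Rightarrow> bool" where
  "positively_oriented \<nu> e \<longleftrightarrow>
     wedge (map (\<lambda>j v. v $ \<nu> j) [1..<Suc CARD('n)]) (map e [1..<Suc CARD('n)]) > 0"

definition dx :: "(nat \<Rightarrow> real^'n) \<Rightarrow> nat \<Rightarrow> (real^'n) \<times> (real^'m) \<Rightarrow> real" where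
  "dx e i v = e i \<bullet> fst v"

definition dy :: "(nat \<Rightarrow> real^'m) \<Rightarrow> nat \<Rightarrow> (real^'n) \<times> (real^'m) \<Rightarrow> real" where
  "dy f i v = f i \<bullet> snd v"

definition C_factor :: "nat \<Rightarrow> (nat \<Rightarrow> real) \<Rightarrow> real" where
  "C_factor r lam = sqrt (\<Prod>i=1..r. 1 + (lam i)\<^sup>2)"

definition S_sum :: "nat \<Rightarrow> (nat \<Rightarrow> real) \<Rightarrow> real" where
  "S_sum r lam = (\<Sum>i=1..r. (lam i)\<^sup>2 / (1 + (lam i)\<^sup>2))"

definition tsai_wang_in_coords ::
    "(nat \<Rightarrow> real^'n) \<Rightarrow> (nat \<Rightarrow> real^'m) \<Rightarrow> nat \<Rightarrow> (nat \<Rightarrow> real) \<Rightarrow>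
     ((real^'n) \<times> (real^'m)) list \<Rightarrow> real" where
  "tsai_wang_in_coords e f r lam vs =
     C_factor r lam *
       ((1 - S_sum r lam) * wedge (map (dx e) [1..<Suc CARD('n)]) vs +
        (\<Sum>i=1..r. (-1) ^ (i - 1) * (lam i / (1 + (lam i)\<^sup>2)) *
           wedge (dy f i # map (dx e) ([1..<i] @ [Suc i..<Suc CARD('n)])) vs))"

text \<open>The value of the form at \<open>p\<close>, for some choice of adapted coordinates at \<open>fst p\<close>.
  Such coordinates always exist, and the form does not depend on the choice.\<close>

definition tsai_wang_form ::
    "(nat \<Rightarrow> 'n) \<Rightarrow> (real^'n \<Rightarrow> real^'m) \<Rightarrow> (real^'n) \<times> (real^'m) \<Rightarrow>
     ((real^'n) \<times> (real^'m)) list \<Rightarrow> real" where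
  "tsai_wang_form \<nu> F p =
     (SOME \<omega>. \<exists>e f r lam.
        is_svd (frechet_derivative F (at (fst p))) e f r lam \<and> positively_oriented \<nu> e \<and>
        \<omega> = tsai_wang_in_coords e f r lam)"

end

theory Submission
  imports Defs
begin

text \<open>On \<open>n\<close> vectors with rows \<open>a\<^sub>i = (dx\<^sub>i(v\<^sub>j))\<^sub>j\<close> and \<open>b\<^sub>i = (dy\<^sub>i(v\<^sub>j))\<^sub>j\<close> the form is a combination of
  \<open>det(a)\<close> and of the determinants of \<open>a\<close> with \<open>a\<^sub>i\<close> replaced by \<open>b\<^sub>i\<close>, while the Gram determinant is
  at least \<open>det(\<Sum>\<^sub>i a\<^sub>i a\<^sub>i\<^sup>T + b\<^sub>i b\<^sub>i\<^sup>T)\<close>. A torus argument, one row at a time, reduces the comass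
  bound to planes spanned by vectors \<open>x\<^sub>i \<partial>/\<partial>x\<^sub>i + y\<^sub>i \<partial>/\<partial>y\<^sub>i\<close> with \<open>x\<^sub>i\<^sup>2 + y\<^sub>i\<^sup>2 = 1\<close>. There, with
  \<open>p\<^sub>i = \<lambda>\<^sub>i\<^sup>2/(1 + \<lambda>\<^sub>i\<^sup>2)\<close>, the bound for \<open>\<S>(\<lambda>) \<le> 1\<close> reads
  \<open>(1 - \<Sum>p\<^sub>i + \<Sum>p\<^sub>i u\<^sub>i)\<^sup>2 \<le> \<Prod>(1 - p\<^sub>i + p\<^sub>i u\<^sub>i\<^sup>2)\<close>, which follows by merging two of the pairs \<open>(p\<^sub>i, u\<^sub>i)\<close> into
  their total weight and weighted mean. The value \<open>1\<close> is attained at the tangent plane of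
  the graph, and the reflected plane, with \<open>-\<lambda>\<close> in place of \<open>\<lambda>\<close>, has value \<open>1 - 2\<S>(\<lambda>) < -1\<close> as soon as
  \<open>\<S>(\<lambda>) > 1\<close>.\<close>

section \<open>Rank-one updates of positive definite matrices\<close>

definition outer :: "real^'n \<Rightarrow> real^'n^'n" where
  "outer w = (\<chi> i j. w $ i * w $ j)"

lemma outer_mult_vec: "outer w *v v = (w \<bullet> v) *\<^sub>R w"
  by (simp add: outer_def matrix_vector_mult_def vec_eq_iff inner_vec_def sum_distrib_left
      sum_distrib_right mult_ac)

lemma outer_scaleR: "outer (t *\<^sub>R w) = t\<^sup>2 *\<^sub>R outer w"
  by (simp add: outer_def vec_eq_iff power2_eq_square)

text \<open>Rotating a pair of vectors preserves its contribution to a Gram matrix. This lets the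
  torus argument pass to an orthogonal pair of rows.\<close>

lemma outer_rotate:
  assumes "x\<^sup>2 + y\<^sup>2 = 1"
  shows "outer (x *\<^sub>R u - y *\<^sub>R v) + outer (y *\<^sub>R u + x *\<^sub>R v) = outer u + outer v"
proof -
  have "(x * a - y * b) * (x * c - y * d) + (y * a + x * b) * (y * c + x * d)
      = (x\<^sup>2 + y\<^sup>2) * (a * c + b * d)" for a b c d
    by (simp add: power2_eq_square algebra_simps)
  then show ?thesis
    using assms by (simp add: outer_def vec_eq_iff)
qed

lemma sum_outer_rows: "(\<Sum>i\<in>UNIV. outer (A $ i)) = transpose A ** A" for A :: "real^'n^'m"
  by (simp add: outer_def transpose_def matrix_matrix_mult_def vec_eq_iff)


lemma det_row_scaleR:
  fixes v :: "real^'n"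
  shows "det (\<chi> i. if i = k then t *\<^sub>R v else c i) = t * det (\<chi> i. if i = k then v else c i)"
  using det_row_mul[of k t "\<lambda>_. v" c] by (simp add: scalar_mult_eq_scaleR cong: if_cong)

lemma det_row_add_const:
  fixes v w :: "real^'n"
  shows "det (\<chi> i. if i = k then v + w else c i) =
    det (\<chi> i. if i = k then v else c i) + det (\<chi> i. if i = k then w else c i)"
  by (rule det_row_add)

text \<open>Adding multiples of row \<open>k\<close> to other rows does not change a determinant:
  after expanding row \<open>l\<close> linearly, the extra term has two equal rows. Without such
  additions the value \<open>w $ k\<close> is Cramer's rule for the identity.\<close>

lemma det_identity_replace_row:
  fixes w :: "real^'n"
  assumes "finite K" "k \<notin> K"
  shows "det (\<chi> i. if i = k then w else if i \<in> K then axis i 1 + u i *\<^sub>R w else axis i 1) = w $ k"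
  using assms
proof (induction K rule: finite_induct)
  case empty
  have r: "row i (mat 1 :: real^'n^'n) = axis i 1" for i
    by (simp add: row_def mat_def axis_def vec_eq_iff eq_commute)
  have "(\<Sum>i\<in>UNIV. w $ i *s row i (mat 1)) = w"
    by (simp add: r basis_expansion)
  with cramer_lemma_transpose[where A = "mat 1 :: real^'n^'n" and x = w and k = k] show ?case
    by (simp add: r cong: if_cong)
next
  case (insert l K)
  then have lk: "l \<noteq> k" by auto
  define c where "c = (\<lambda>i. if i = k then w else if i \<in> K then axis i 1 + u i *\<^sub>R w else axis i 1)"
  have "(\<chi> i. if i = k then w else if i \<in> insert l K then axis i 1 + u i *\<^sub>R w else axis i 1)
      = (\<chi> i. if i = l then axis l 1 + u l *\<^sub>R w else c i)"
    using lk by (auto simp: vec_eq_iff c_def)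
  then have "det (\<chi> i. if i = k then w else if i \<in> insert l K then axis i 1 + u i *\<^sub>R w else axis i 1)
      = det (\<chi> i. if i = l then axis l 1 else c i) + u l * det (\<chi> i. if i = l then w else c i)"
    by (simp only: det_row_add_const[of l "axis l 1"] det_row_scaleR[of l "u l" w])
  also have "det (\<chi> i. if i = l then w else c i) = 0"
    by (rule det_identical_rows[OF lk]) (use lk in \<open>simp add: row_def c_def\<close>)
  also have "(\<chi> i. if i = l then axis l 1 else c i) = (\<chi> i. c i)"
    using lk insert.hyps by (auto simp: vec_eq_iff c_def)
  finally show ?case
    using insert by (simp add: c_def)
qed

text \<open>The matrix determinant lemma, perturbing one row at a time: \<open>K\<close> is the set
  of rows already perturbed, and a new row \<open>l\<close> contributes \<open>u l * w $ l\<close>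
  by the previous lemma.\<close>

lemma det_identity_plus_rank_one_aux:
  fixes w :: "real^'n"
  assumes "finite K"
  shows "det (\<chi> i. if i \<in> K then axis i 1 + u i *\<^sub>R w else axis i 1) = 1 + (\<Sum>i\<in>K. u i * w $ i)"
  using assms
proof (induction K rule: finite_induct)
  case empty
  have "(\<chi> i. axis i 1) = (mat 1 :: real^'n^'n)"
    by (simp add: mat_def axis_def vec_eq_iff)
  then show ?case by simp
next
  case (insert l K)
  define c where "c = (\<lambda>i. if i \<in> K then axis i 1 + u i *\<^sub>R w else axis i 1)"
  have "(\<chi> i. if i \<in> insert l K then axis i 1 + u i *\<^sub>R w else axis i 1)
      = (\<chi> i. if i = l then axis l 1 + u l *\<^sub>R w else c i)"
    by (auto simp: vec_eq_iff c_def)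
  then have "det (\<chi> i. if i \<in> insert l K then axis i 1 + u i *\<^sub>R w else axis i 1)
      = det (\<chi> i. if i = l then axis l 1 else c i) + u l * det (\<chi> i. if i = l then w else c i)"
    by (simp only: det_row_add_const[of l "axis l 1"] det_row_scaleR[of l "u l" w])
  also have "det (\<chi> i. if i = l then w else c i) = w $ l"
    unfolding c_def by (rule det_identity_replace_row) (use insert in auto)
  also have "(\<chi> i. if i = l then axis l 1 else c i) = (\<chi> i. c i)"
    using insert.hyps by (auto simp: vec_eq_iff c_def)
  finally show ?case
    using insert by (simp add: c_def)
qed

lemma det_identity_plus_rank_one:
  fixes u w :: "real^'n"
  shows "det (mat 1 + (\<chi> i j. u $ i * w $ j)) = 1 + u \<bullet> w"
proof -
  have "mat 1 + (\<chi> i j. u $ i * w $ j) = (\<chi> i. axis i 1 + u $ i *\<^sub>R w)"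
    by (simp add: mat_def axis_def vec_eq_iff)
  with det_identity_plus_rank_one_aux[of UNIV "($) u" w] show ?thesis
    by (simp add: inner_vec_def)
qed

text \<open>Since \<open>M *v u = w\<close>, the update factors as \<open>M\<close> times the
  identity plus a rank-one matrix. Taking a solution \<open>u\<close> as data avoids writing an
  inverse.\<close>

lemma det_add_outer:
  fixes M :: "real^'n^'n"
  assumes "M *v u = w"
  shows "det (M + outer w) = det M * (1 + u \<bullet> w)"
proof -
  have "M ** (\<chi> i j. u $ i * w $ j) = outer w"
  proof -
    have "(\<Sum>k\<in>UNIV. M $ i $ k * (u $ k * w $ j)) = w $ i * w $ j" for i j
      using arg_cong[OF assms, of "\<lambda>v. v $ i"]
      by (simp add: matrix_vector_mult_def sum_distrib_right mult.assoc[symmetric] flip: sum_distrib_right)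
    then show ?thesis
      by (simp add: outer_def matrix_matrix_mult_def)
  qed
  then have "M + outer w = M ** (mat 1 + (\<chi> i j. u $ i * w $ j))"
    by (simp add: matrix_add_ldistrib)
  then show ?thesis
    by (simp add: det_mul det_identity_plus_rank_one)
qed

text \<open>Positivity of the determinant follows from the first two conditions; having it in the
  definition costs nothing, as every matrix below is built up from rank-one matrices.\<close>

definition pos_def :: "real^'n^'n \<Rightarrow> bool" where
  "pos_def M \<longleftrightarrow> transpose M = M \<and> (\<forall>v. v \<noteq> 0 \<longrightarrow> v \<bullet> (M *v v) > 0) \<and> det M > 0"

lemma pos_def_nonneg: "pos_def M \<Longrightarrow> v \<bullet> (M *v v) \<ge> 0"
  by (cases "v = 0") (auto simp: pos_def_def less_imp_le)

lemma pos_def_sym: "pos_def M \<Longrightarrow> (M *v u) \<bullet> v = u \<bullet> (M *v v)"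
  by (metis dot_lmul_matrix pos_def_def transpose_matrix_vector vector_transpose_matrix)

lemma pos_def_solve:
  fixes w :: "real^'n"
  assumes "pos_def M"
  obtains u where "M *v u = w"
proof -
  have "invertible M"
    using assms by (simp add: pos_def_def invertible_det_nz)
  then obtain B where "M ** B = mat 1"
    unfolding invertible_def by blast
  then have "M *v (B *v w) = w"
    by (simp add: matrix_vector_mul_assoc)
  then show ?thesis by (rule that)
qed

text \<open>A stand-in for positive semidefiniteness that needs no spectral theory: rank-one squares
  have the property and it is additive. Preservation of \<open>pos_def\<close> is included so that
  updates can be chained.\<close>

definition det_increasing :: "real^'n^'n \<Rightarrow> bool" where
  "det_increasing E \<longleftrightarrow> (\<forall>M. pos_def M \<longrightarrow> pos_def (M + E) \<and> det M \<le> det (M + E))"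

text \<open>With \<open>M *v u = w\<close> the determinant is multiplied by
  \<open>1 + u \<bullet> w\<close>, and \<open>u \<bullet> w\<close> is the value of the quadratic
  form of \<open>M\<close> at \<open>u\<close>, hence nonnegative.\<close>

lemma det_increasing_outer:
  fixes w :: "real^'n"
  shows "det_increasing (outer w)"
  unfolding det_increasing_def
proof (intro allI impI)
  fix M :: "real^'n^'n" assume M: "pos_def M"
  then obtain u where u: "M *v u = w" by (rule pos_def_solve)
  have "u \<bullet> w \<ge> 0"
    using pos_def_nonneg[OF M] u by auto
  moreover have "v \<bullet> ((M + outer w) *v v) = v \<bullet> (M *v v) + (v \<bullet> w)\<^sup>2" for v
    by (simp add: matrix_vector_mult_add_rdistrib outer_mult_vec inner_add_right power2_eq_square
        inner_commute)
  moreover have "transpose (M + outer w) = M + outer w"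
    using M by (simp add: pos_def_def transpose_def outer_def vec_eq_iff mult.commute)
  ultimately show "pos_def (M + outer w) \<and> det M \<le> det (M + outer w)"
    using M by (auto simp: pos_def_def det_add_outer[OF u] add_pos_nonneg)
qed

lemma det_increasing_0: "det_increasing 0"
  by (simp add: det_increasing_def)

lemma det_increasing_add:
  assumes "det_increasing A" "det_increasing B"
  shows "det_increasing (A + B)"
  unfolding det_increasing_def add.assoc[symmetric]
  using assms unfolding det_increasing_def by (meson order_trans)

lemma det_increasing_sum: "(\<And>i. i \<in> I \<Longrightarrow> det_increasing (A i)) \<Longrightarrow> det_increasing (sum A I)"
  by (induction I rule: infinite_finite_induct) (auto intro: det_increasing_add det_increasing_0)

lemma pos_def_mat:
  assumes "\<epsilon> > 0"
  shows "pos_def (mat \<epsilon> :: real^'n^'n)"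
proof -
  have "(mat \<epsilon> :: real^'n^'n) *v v = \<epsilon> *\<^sub>R v" for v
    by (simp add: matrix_vector_mult_def mat_def vec_eq_iff if_distrib[of "\<lambda>x. x * _"] cong: if_cong)
  moreover have "det (mat \<epsilon> :: real^'n^'n) = \<epsilon> ^ CARD('n)"
    by (subst det_diagonal) (simp_all add: mat_def)
  ultimately show ?thesis
    using assms by (simp add: pos_def_def transpose_mat)
qed

lemma det_increasing_mat:
  assumes "\<epsilon> \<ge> 0"
  shows "det_increasing (mat \<epsilon> :: real^'n^'n)"
proof -
  have "mat (sqrt \<epsilon>) ** (mat (sqrt \<epsilon>) :: real^'n^'n) = (mat \<epsilon> :: real^'n^'n)"
    using assms by (simp add: matrix_matrix_mult_def mat_def vec_eq_iff if_distrib[of "\<lambda>x. x * _"]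
        if_distrib[of "\<lambda>x. _ * x"] sum.delta' cong: if_cong)
  then have "(mat \<epsilon> :: real^'n^'n) = (\<Sum>i\<in>UNIV. outer ((mat (sqrt \<epsilon>) :: real^'n^'n) $ i))"
    by (simp only: sum_outer_rows transpose_mat)
  then show "det_increasing (mat \<epsilon> :: real^'n^'n)"
    by (simp add: det_increasing_sum det_increasing_outer)
qed

text \<open>For invertible \<open>A\<close> the sum is the positive definite matrix
  \<open>transpose A ** A\<close> of determinant \<open>(det A)\<^sup>2\<close>, and adding
  \<open>E\<close> can only increase it. For singular \<open>A\<close> only positivity of the right
  side is at stake, and it comes from \<open>pos_def E\<close>.\<close>

lemma det_square_le_det_add_gram:
  fixes A :: "real^'n^'n"
  assumes "pos_def E" "det_increasing E"
  shows "(det A)\<^sup>2 \<le> det (E + (\<Sum>i\<in>UNIV. outer (A $ i)))"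
proof (cases "det A = 0")
  case True
  have "det_increasing (\<Sum>i\<in>UNIV. outer (A $ i))"
    by (simp add: det_increasing_sum det_increasing_outer)
  with assms(1) True show ?thesis
    by (auto simp: det_increasing_def pos_def_def less_imp_le)
next
  case False
  let ?G = "transpose A ** A"
  have "v \<bullet> (?G *v v) > 0" if "v \<noteq> 0" for v
  proof -
    have "v \<bullet> (?G *v v) = (A *v v) \<bullet> (A *v v)"
      by (metis dot_lmul_matrix matrix_vector_mul_assoc transpose_matrix_vector inner_commute)
    moreover have "A *v v \<noteq> 0"
      using False that by (metis invertible_det_nz matrix_left_invertible_ker invertible_def)
    ultimately show ?thesis by simp
  qed
  moreover have "det ?G = (det A)\<^sup>2"
    by (simp add: det_mul power2_eq_square)
  ultimately have "pos_def ?G"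
    using False by (simp add: pos_def_def matrix_transpose_mul)
  with assms(2) show ?thesis
    by (simp add: det_increasing_def sum_outer_rows \<open>det ?G = _\<close>[symmetric] add.commute[of E])
qed

section \<open>The torus argument\<close>

definition replace_row :: "'n \<Rightarrow> real^'n \<Rightarrow> real^'n^'n \<Rightarrow> real^'n^'n" where
  "replace_row k v A = (\<chi> i. if i = k then v else A $ i)"

lemma replace_row_nth: "replace_row k v A $ i = (if i = k then v else A $ i)"
  by (simp add: replace_row_def)

lemma replace_row_same [simp]: "replace_row k (A $ k) A = A"
  by (simp add: replace_row_def vec_eq_iff)

lemma det_replace_row_add:
  "det (replace_row k (v + w) A) = det (replace_row k v A) + det (replace_row k w A)"
  unfolding replace_row_def by (rule det_row_add_const)

lemma det_replace_row_scaleR: "det (replace_row k (t *\<^sub>R v) A) = t * det (replace_row k v A)"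
  unfolding replace_row_def by (rule det_row_scaleR)

text \<open>With suitable coefficients this is the Tsai--Wang form on a list of vectors,
  \<open>A\<close> holding the dx-values and \<open>B\<close> the dy-values.\<close>

definition row_form :: "real \<Rightarrow> ('n \<Rightarrow> real) \<Rightarrow> real^'n^'n \<Rightarrow> real^'n^'n \<Rightarrow> real" where
  "row_form \<alpha> \<beta> A B = \<alpha> * det A + (\<Sum>i\<in>UNIV. \<beta> i * det (replace_row i (B $ i) A))"

lemma replace_row_replace_row:
  "replace_row i (replace_row k w B $ i) (replace_row k v A) =
     replace_row k (if i = k then w else v) (replace_row i (B $ i) A)"
  by (simp add: replace_row_def vec_eq_iff)

text \<open>Every determinant in the form contains exactly one of the two \<open>k\<close>-th rows,
  so the form is linear in the pair of rows jointly.\<close>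

lemma row_form_add:
  "row_form \<alpha> \<beta> (replace_row k (v + v') A) (replace_row k (w + w') B) =
     row_form \<alpha> \<beta> (replace_row k v A) (replace_row k w B) +
     row_form \<alpha> \<beta> (replace_row k v' A) (replace_row k w' B)"
proof -
  have "det (replace_row k (if i = k then w + w' else v + v') C) =
      det (replace_row k (if i = k then w else v) C) + det (replace_row k (if i = k then w' else v') C)"
    for i C
    by (simp add: det_replace_row_add)
  then show ?thesis
    by (simp add: row_form_def replace_row_replace_row det_replace_row_add distrib_left sum.distrib)
qed

lemma row_form_scaleR:
  "row_form \<alpha> \<beta> (replace_row k (t *\<^sub>R v) A) (replace_row k (t *\<^sub>R w) B) =
     t * row_form \<alpha> \<beta> (replace_row k v A) (replace_row k w B)"
proof -
  have "det (replace_row k (if i = k then t *\<^sub>R w else t *\<^sub>R v) C) =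
      t * det (replace_row k (if i = k then w else v) C)" for i C
    by (simp add: det_replace_row_scaleR)
  then show ?thesis
    by (simp add: row_form_def replace_row_replace_row det_replace_row_scaleR distrib_left
        sum_distrib_left mult_ac)
qed

lemma det_scaleR_rows: "det (\<chi> i. t i *\<^sub>R C $ i) = prod t UNIV * det C" for C :: "real^'n^'n"
  using det_rows_mul[of t "\<lambda>i. C $ i"] by (simp add: scalar_mult_eq_scaleR)

text \<open>When both \<open>i\<close>-th rows are multiples of one vector, the scalars come out and
  leave a function on the torus times a single determinant.\<close>

lemma row_form_product:
  fixes C :: "real^'n^'n"
  shows "row_form \<alpha> \<beta> (\<chi> i. x i *\<^sub>R C $ i) (\<chi> i. y i *\<^sub>R C $ i) =
     (\<alpha> * prod x UNIV + (\<Sum>i\<in>UNIV. \<beta> i * (y i * prod x (UNIV - {i})))) * det C"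
proof -
  have "replace_row i (y i *\<^sub>R C $ i) (\<chi> i. x i *\<^sub>R C $ i) = (\<chi> j. (if j = i then y i else x j) *\<^sub>R C $ j)"
    for i by (simp add: replace_row_def vec_eq_iff)
  moreover have "(\<Prod>j\<in>UNIV. if j = i then y i else x j) = y i * prod x (UNIV - {i})" for i
    by (subst prod.remove[of UNIV i]) (auto intro!: prod.cong)
  ultimately show ?thesis
    by (simp add: row_form_def det_scaleR_rows distrib_right sum_distrib_right mult.assoc)
qed

text \<open>Diagonalises the symmetric 2 by 2 matrix with diagonal \<open>P\<close>,
  \<open>R\<close> and off-diagonal entry \<open>Q\<close>: the rotation angle is half the polar
  angle of \<open>(P - R, 2 * Q)\<close>.\<close>

lemma orthogonalizing_rotation:
  fixes P Q R :: real
  obtains x y :: real where "x\<^sup>2 + y\<^sup>2 = 1" "x * y * (R - P) + (x\<^sup>2 - y\<^sup>2) * Q = 0"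
proof -
  obtain \<rho> t where "P - R = \<rho> * cos t" "2 * Q = \<rho> * sin t"
    using polar_Ex by blast
  define x where "x = cos (t / 2)"
  define y where "y = sin (t / 2)"
  have c: "cos t = x\<^sup>2 - y\<^sup>2" and s: "sin t = 2 * x * y"
    using cos_double[of "t / 2"] sin_double[of "t / 2"] by (simp_all add: x_def y_def)
  have "R - P = - (\<rho> * cos t)" "Q = \<rho> * sin t / 2"
    using \<open>P - R = _\<close> \<open>2 * Q = _\<close> by simp_all
  then have "x * y * (R - P) + (x\<^sup>2 - y\<^sup>2) * Q
      = x * y * - (\<rho> * (x\<^sup>2 - y\<^sup>2)) + (x\<^sup>2 - y\<^sup>2) * (\<rho> * (2 * x * y) / 2)"
    by (simp only: c s)
  also have "\<dots> = 0"
    by simp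
  finally show ?thesis
    by (intro that[of x y]) (simp_all add: x_def y_def)
qed

text \<open>Dividing by the square of \<open>t\<close> makes the constant \<open>c\<close>
  negligible for large \<open>t\<close>; one explicit large \<open>t\<close> suffices.\<close>

lemma le_of_scaled_bound:
  fixes a b c :: real
  assumes "\<And>t. t\<^sup>2 * a \<le> c + t\<^sup>2 * b"
  shows "a \<le> b"
proof (rule ccontr)
  assume "\<not> a \<le> b"
  define t where "t = sqrt ((\<bar>c\<bar> + 1) / (a - b))"
  have "t\<^sup>2 * (a - b) = \<bar>c\<bar> + 1"
    using \<open>\<not> a \<le> b\<close> by (simp add: t_def)
  moreover have "t\<^sup>2 * (a - b) \<le> c"
    using assms[of t] by (simp add: right_diff_distrib)
  ultimately show False
    by linarith
qed

text \<open>The cross term is at most \<open>2 * D * sqrt (a * b)\<close>, and the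
  arithmetic-geometric mean inequality bounds this by \<open>D * (1 + a * b)\<close>.\<close>

lemma add_squared_le_mult:
  fixes p q a b D :: real
  assumes "p\<^sup>2 \<le> D * a" "q\<^sup>2 \<le> D * b" "a \<ge> 0" "b \<ge> 0" "D \<ge> 0"
  shows "(p + q)\<^sup>2 \<le> D * ((1 + a) * (1 + b))"
proof -
  obtain r where r: "r \<ge> 0" "r\<^sup>2 = a * b"
    using assms by (metis mult_nonneg_nonneg real_sqrt_ge_zero real_sqrt_pow2)
  have "(p * q)\<^sup>2 \<le> (D * a) * (D * b)"
    unfolding power_mult_distrib using assms by (intro mult_mono) auto
  also have "\<dots> = (D * r)\<^sup>2"
    unfolding power_mult_distrib r by algebra
  finally have "p * q \<le> D * r"
    by (rule power2_le_imp_le) (use assms r in simp)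
  moreover have "2 * r \<le> 1 + a * b"
    using sum_squares_bound[of 1 r] r by simp
  then have "D * (2 * r) \<le> D * (1 + a * b)"
    using assms by (intro mult_left_mono)
  ultimately have "p\<^sup>2 + q\<^sup>2 + 2 * (p * q) \<le> D * a + D * b + D * (1 + a * b)"
    using assms by linarith
  then show ?thesis
    by (simp add: power2_sum algebra_simps)
qed

text \<open>The torus argument: once \<open>a\<^sub>k\<close>, \<open>b\<^sub>k\<close> are rotated into vectors that are orthogonal for
  the inverse of the remaining Gram matrix, the determinant splits off the factor
  \<open>(1 + |a|\<^sup>2)(1 + |b|\<^sup>2) \<ge> (|a| + |b|)\<^sup>2\<close>, so the extremal case has \<open>a\<^sub>k\<close> and \<open>b\<^sub>k\<close> parallel.\<close>

lemma row_form_le_pos_def: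
  fixes A B E :: "real^'n^'n"
  assumes E: "pos_def E" "det_increasing E" and c: "c \<ge> 0"
    and torus: "\<And>x y. (\<And>i. (x i)\<^sup>2 + (y i)\<^sup>2 = 1) \<Longrightarrow>
       \<bar>\<alpha> * prod x UNIV + (\<Sum>i\<in>UNIV. \<beta> i * (y i * prod x (UNIV - {i})))\<bar> \<le> c"
    and "finite K"
    and "\<And>i. i \<notin> K \<Longrightarrow> \<exists>x y v. x\<^sup>2 + y\<^sup>2 = 1 \<and> A $ i = x *\<^sub>R v \<and> B $ i = y *\<^sub>R v"
  shows "(row_form \<alpha> \<beta> A B)\<^sup>2 \<le> c\<^sup>2 * det (E + (\<Sum>i\<in>UNIV. outer (A $ i) + outer (B $ i)))"
  using assms(5,6)
\<comment> \<open>\<open>K\<close> contains all rows where \<open>A\<close> and \<open>B\<close> may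
  fail to be parallel. The base case is a pure torus point times \<open>det C\<close>; the step
  splits row \<open>k\<close> into two parallel pairs.\<close>
proof (induction K arbitrary: A B rule: finite_induct)
  case empty
  then have "\<forall>i. \<exists>x y v. x\<^sup>2 + y\<^sup>2 = 1 \<and> A $ i = x *\<^sub>R v \<and> B $ i = y *\<^sub>R v"
    by simp
  then obtain x y V where xy: "\<And>i. (x i)\<^sup>2 + (y i)\<^sup>2 = 1"
    and AB: "\<And>i. A $ i = x i *\<^sub>R V i" "\<And>i. B $ i = y i *\<^sub>R V i"
    by metis
  define C :: "real^'n^'n" where "C = (\<chi> i. V i)"
  have A: "A = (\<chi> i. x i *\<^sub>R C $ i)" and B: "B = (\<chi> i. y i *\<^sub>R C $ i)"
    by (simp_all add: vec_eq_iff C_def AB)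
  have "outer (A $ i) + outer (B $ i) = outer (C $ i)" for i
    using xy[of i] by (simp add: A B outer_scaleR scaleR_add_left[symmetric])
  moreover have "(row_form \<alpha> \<beta> A B)\<^sup>2 \<le> c\<^sup>2 * (det C)\<^sup>2"
    unfolding A B row_form_product power_mult_distrib
    by (intro mult_right_mono) (use torus[OF xy] c in \<open>auto simp: abs_le_square_iff[symmetric]\<close>)
  moreover have "(det C)\<^sup>2 \<le> det (E + (\<Sum>i\<in>UNIV. outer (C $ i)))"
    by (rule det_square_le_det_add_gram[OF E])
  ultimately show ?case
    by (smt (verit) mult_left_mono sum.cong zero_le_power2)
next
  case (insert k K)
  define M where "M = E + (\<Sum>i\<in>UNIV - {k}. outer (A $ i) + outer (B $ i))"
  have gram: "E + (\<Sum>i\<in>UNIV. outer (replace_row k v A $ i) + outer (replace_row k w B $ i))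
      = M + (outer v + outer w)" for v w
    unfolding M_def sum.remove[OF finite UNIV_I[of k]]
    by (simp add: replace_row_nth add_ac cong: sum.cong_simp)
  have "det_increasing (\<Sum>i\<in>UNIV - {k}. outer (A $ i) + outer (B $ i))"
    by (intro det_increasing_sum det_increasing_add det_increasing_outer)
  then have M: "pos_def M"
    using E unfolding M_def det_increasing_def by blast
  then have detM: "det M > 0" by (simp add: pos_def_def)
  obtain u where u: "M *v u = A $ k" using pos_def_solve[OF M] by metis
  obtain w where w: "M *v w = B $ k" using pos_def_solve[OF M] by metis
  \<comment> \<open>The rotation is chosen to make \<open>u' \<bullet> b\<close> vanish below, that
    is, \<open>a\<close> and \<open>b\<close> orthogonal for the inverse of
    \<open>M\<close>.\<close>
  obtain x y where xy: "x\<^sup>2 + y\<^sup>2 = 1"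
    and orth: "x * y * (w \<bullet> B $ k - u \<bullet> A $ k) + (x\<^sup>2 - y\<^sup>2) * (u \<bullet> B $ k) = 0"
    by (rule orthogonalizing_rotation)
  define a where "a = x *\<^sub>R A $ k + y *\<^sub>R B $ k"
  define b where "b = x *\<^sub>R B $ k - y *\<^sub>R A $ k"
  define u' where "u' = x *\<^sub>R u + y *\<^sub>R w"
  define w' where "w' = x *\<^sub>R w - y *\<^sub>R u"
  have u': "M *v u' = a" and w': "M *v w' = b"
    by (simp_all add: u'_def w'_def a_def b_def u w matrix_vector_right_distrib
        matrix_vector_mult_diff_distrib matrix_vector_mult_scaleR)
  have wA: "w \<bullet> A $ k = u \<bullet> B $ k"
    using pos_def_sym[OF M, of w u] by (simp add: u w inner_commute)
  have ub: "u' \<bullet> b = 0"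
    using orth by (simp add: u'_def b_def inner_add_left inner_diff_right wA power2_eq_square algebra_simps)
  have "x * (x * p + y * q) - y * (x * q - y * p) = (x\<^sup>2 + y\<^sup>2) * p"
    and "y * (x * p + y * q) + x * (x * q - y * p) = (x\<^sup>2 + y\<^sup>2) * q" for p q
    by (simp_all add: power2_eq_square algebra_simps)
  then have Ak: "A $ k = x *\<^sub>R a - y *\<^sub>R b" and Bk: "B $ k = y *\<^sub>R a + x *\<^sub>R b"
    by (simp_all add: vec_eq_iff a_def b_def xy)
  have det1: "det (M + outer v) = det M * (1 + s \<bullet> v)" if "M *v s = v" for s v
    using that by (rule det_add_outer)
  \<comment> \<open>Row \<open>k\<close> is now a parallel pair, so the induction hypothesis
    applies. For the row scaled by \<open>t\<close> it gives the factor
    \<open>1 + t\<^sup>2 * (s \<bullet> v)\<close>; letting \<open>t\<close> grow removes the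
    summand 1.\<close>
  have split_bound: "(row_form \<alpha> \<beta> (replace_row k (p *\<^sub>R v) A) (replace_row k (q *\<^sub>R v) B))\<^sup>2
      \<le> (c\<^sup>2 * det M) * (s \<bullet> v)" if "p\<^sup>2 + q\<^sup>2 = 1" "M *v s = v" for p q s v
  proof (rule le_of_scaled_bound)
    fix t
    have "(row_form \<alpha> \<beta> (replace_row k (t *\<^sub>R p *\<^sub>R v) A) (replace_row k (t *\<^sub>R q *\<^sub>R v) B))\<^sup>2
        \<le> c\<^sup>2 * det (E + (\<Sum>i\<in>UNIV. outer (replace_row k (t *\<^sub>R p *\<^sub>R v) A $ i)
              + outer (replace_row k (t *\<^sub>R q *\<^sub>R v) B $ i)))"
    proof (rule insert.IH)
      fix i assume "i \<notin> K"
      show "\<exists>x y z. x\<^sup>2 + y\<^sup>2 = 1 \<and> replace_row k (t *\<^sub>R p *\<^sub>R v) A $ i = x *\<^sub>R z \<and>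
              replace_row k (t *\<^sub>R q *\<^sub>R v) B $ i = y *\<^sub>R z"
      proof (cases "i = k")
        case True
        then show ?thesis
          using that(1) by (intro exI[of _ p] exI[of _ q] exI[of _ "t *\<^sub>R v"])
            (simp add: replace_row_nth mult.commute)
      next
        case False
        with \<open>i \<notin> K\<close> insert.prems[of i] show ?thesis
          by (simp add: replace_row_nth)
      qed
    qed
    also have "outer (t *\<^sub>R p *\<^sub>R v) + outer (t *\<^sub>R q *\<^sub>R v) = outer (t *\<^sub>R v)"
      using that(1) by (simp add: outer_scaleR scaleR_add_left[symmetric] distrib_left[symmetric]
          flip: power_mult_distrib) (simp add: power_mult_distrib distrib_left[symmetric] 
           scaleR_add_left[symmetric])
    then have "det (E + (\<Sum>i\<in>UNIV. outer (replace_row k (t *\<^sub>R p *\<^sub>R v) A $ i)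
              + outer (replace_row k (t *\<^sub>R q *\<^sub>R v) B $ i))) = det M * (1 + (t *\<^sub>R s) \<bullet> (t *\<^sub>R v))"
      unfolding gram using det1[of "t *\<^sub>R s" "t *\<^sub>R v"] that(2)
      by (simp add: matrix_vector_mult_scaleR)
    finally show "t\<^sup>2 * (row_form \<alpha> \<beta> (replace_row k (p *\<^sub>R v) A) (replace_row k (q *\<^sub>R v) B))\<^sup>2
        \<le> c\<^sup>2 * det M + t\<^sup>2 * ((c\<^sup>2 * det M) * (s \<bullet> v))"
      unfolding row_form_scaleR by (simp add: power2_eq_square algebra_simps)
  qed
  have "row_form \<alpha> \<beta> A B = row_form \<alpha> \<beta> (replace_row k (A $ k) A) (replace_row k (B $ k) B)"
    by simp
  also have "\<dots> = row_form \<alpha> \<beta> (replace_row k (x *\<^sub>R a) A) (replace_row k (y *\<^sub>R a) B)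
      + row_form \<alpha> \<beta> (replace_row k ((- y) *\<^sub>R b) A) (replace_row k (x *\<^sub>R b) B)"
    unfolding Ak Bk row_form_add[symmetric] by simp
  also have "\<dots>\<^sup>2 \<le> (c\<^sup>2 * det M) * ((1 + u' \<bullet> a) * (1 + w' \<bullet> b))"
  proof (rule add_squared_le_mult)
    show "u' \<bullet> a \<ge> 0" "w' \<bullet> b \<ge> 0"
      using pos_def_nonneg[OF M] u' w' by metis+
    show "(row_form \<alpha> \<beta> (replace_row k (x *\<^sub>R a) A) (replace_row k (y *\<^sub>R a) B))\<^sup>2
        \<le> c\<^sup>2 * det M * (u' \<bullet> a)"
      by (rule split_bound[OF xy u'])
    show "(row_form \<alpha> \<beta> (replace_row k ((- y) *\<^sub>R b) A) (replace_row k (x *\<^sub>R b) B))\<^sup>2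
        \<le> c\<^sup>2 * det M * (w' \<bullet> b)"
      by (rule split_bound[OF _ w']) (use xy in simp)
    show "0 \<le> c\<^sup>2 * det M"
      using detM by simp
  qed
  \<comment> \<open>Orthogonality means that \<open>w'\<close> still solves the equation for
    \<open>b\<close> after \<open>outer a\<close> has been added, so the two updates contribute
    independent factors.\<close>
  also have "det M * ((1 + u' \<bullet> a) * (1 + w' \<bullet> b)) = det (M + outer a + outer b)"
  proof -
    have "w' \<bullet> a = 0"
      using pos_def_sym[OF M, of u' w'] ub by (simp add: u' w' inner_commute)
    then have "(M + outer a) *v w' = b"
      by (simp add: matrix_vector_mult_add_rdistrib w' outer_mult_vec inner_commute)
    then show ?thesis
      by (simp add: det_add_outer det1[OF u'])
  qed
  then have "(c\<^sup>2 * det M) * ((1 + u' \<bullet> a) * (1 + w' \<bullet> b)) = c\<^sup>2 * det (M + outer a + outer b)"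
    by (simp add: mult.assoc)
  also have "M + outer a + outer b = M + (outer (A $ k) + outer (B $ k))"
    unfolding Ak Bk by (simp add: outer_rotate[OF xy])
  also have "\<dots> = E + (\<Sum>i\<in>UNIV. outer (A $ i) + outer (B $ i))"
    using gram[of "A $ k" "B $ k"] by simp
  finally show ?case .
qed

section \<open>The scalar inequality on the torus\<close>

text \<open>Homogeneous form of merging the weights \<open>s\<close>, \<open>q\<close> at the points
  \<open>Y / X\<close>, \<open>Y' / X'\<close> into their weighted mean. After multiplication by
  \<open>s + q\<close> the difference of the sides is \<open>s * q\<close> times a nonnegative
  combination of two squares.\<close>

lemma weighted_merge:
  fixes s q X Y X' Y' :: real
  assumes "s \<ge> 0" "q \<ge> 0" "s + q \<le> 1" "s + q > 0"
  shows "(1 - (s + q)) * (X * X')\<^sup>2 + (s + q) * ((s * Y * X' + q * X * Y') / (s + q))\<^sup>2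
    \<le> ((1 - s) * X\<^sup>2 + s * Y\<^sup>2) * ((1 - q) * X'\<^sup>2 + q * Y'\<^sup>2)"
proof -
  define t where "t = s + q"
  have "t * (((1 - s) * X\<^sup>2 + s * Y\<^sup>2) * ((1 - q) * X'\<^sup>2 + q * Y'\<^sup>2))
      - (t * (1 - t) * (X * X')\<^sup>2 + (s * Y * X' + q * X * Y')\<^sup>2)
      = s * q * (t * (X * X' - Y * Y')\<^sup>2 + (1 - t) * (Y * X' - X * Y')\<^sup>2)"
    unfolding t_def by algebra
  also have "\<dots> \<ge> 0"
    using assms by (simp add: t_def)
  finally have le: "t * (1 - t) * (X * X')\<^sup>2 + (s * Y * X' + q * X * Y')\<^sup>2
      \<le> t * (((1 - s) * X\<^sup>2 + s * Y\<^sup>2) * ((1 - q) * X'\<^sup>2 + q * Y'\<^sup>2))"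
    by simp
  have t: "t > 0" using assms by (simp add: t_def)
  have "t * ((1 - t) * (X * X')\<^sup>2 + t * ((s * Y * X' + q * X * Y') / t)\<^sup>2)
      = t * (1 - t) * (X * X')\<^sup>2 + (s * Y * X' + q * X * Y')\<^sup>2"
    using t by (simp add: power_divide power2_eq_square[of t] distrib_left)
  with le have "t * ((1 - t) * (X * X')\<^sup>2 + t * ((s * Y * X' + q * X * Y') / t)\<^sup>2)
      \<le> t * (((1 - s) * X\<^sup>2 + s * Y\<^sup>2) * ((1 - q) * X'\<^sup>2 + q * Y'\<^sup>2))"
    by linarith
  then show ?thesis
    unfolding t_def[symmetric] using t by (simp only: mult_le_cancel_left_pos)
qed

text \<open>The left side has the same shape as one factor on the right, with total weight
  \<open>sum p I\<close>, so that \<open>weighted_merge\<close> can be iterated. \<open>Z\<close> is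
  given only through its product with the total weight, which may be zero.\<close>

lemma weighted_product_inequality_strong:
  fixes p X Y :: "'i \<Rightarrow> real"
  assumes "finite I" "\<And>i. i \<in> I \<Longrightarrow> p i \<ge> 0" "sum p I \<le> 1"
  shows "\<exists>Z. sum p I * Z = (\<Sum>i\<in>I. p i * Y i * prod X (I - {i})) \<and>
    (1 - sum p I) * (prod X I)\<^sup>2 + sum p I * Z\<^sup>2 \<le> (\<Prod>i\<in>I. (1 - p i) * (X i)\<^sup>2 + p i * (Y i)\<^sup>2)"
  using assms
proof (induction I rule: finite_induct)
  case empty
  then show ?case by simp
next
  case (insert j I)
  define s where "s = sum p I"
  have s: "s \<ge> 0" "p j \<ge> 0" "s + p j \<le> 1"
    using insert.prems insert.hyps by (auto simp: s_def sum_nonneg add.commute)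
  then obtain Z where Z: "s * Z = (\<Sum>i\<in>I. p i * Y i * prod X (I - {i}))"
    and le: "(1 - s) * (prod X I)\<^sup>2 + s * Z\<^sup>2 \<le> (\<Prod>i\<in>I. (1 - p i) * (X i)\<^sup>2 + p i * (Y i)\<^sup>2)"
    using insert.IH insert.prems unfolding s_def by force
  have "prod X (insert j I - {i}) = X j * prod X (I - {i})" if "i \<in> I" for i
  proof -
    have "insert j I - {i} = insert j (I - {i})" using that insert.hyps by auto
    then show ?thesis using insert.hyps by simp
  qed
  then have "(\<Sum>i\<in>I. p i * Y i * prod X (insert j I - {i})) = X j * (s * Z)"
    unfolding Z sum_distrib_left by (intro sum.cong) auto
  then have sum: "(\<Sum>i\<in>insert j I. p i * Y i * prod X (insert j I - {i}))
      = s * Z * X j + p j * prod X I * Y j"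
    using insert.hyps by (simp add: mult_ac)
  have P: "sum p (insert j I) = s + p j"
    using insert.hyps by (simp add: s_def)
  have "((1 - s) * (prod X I)\<^sup>2 + s * Z\<^sup>2) * ((1 - p j) * (X j)\<^sup>2 + p j * (Y j)\<^sup>2)
      \<le> (\<Prod>i\<in>I. (1 - p i) * (X i)\<^sup>2 + p i * (Y i)\<^sup>2) * ((1 - p j) * (X j)\<^sup>2 + p j * (Y j)\<^sup>2)"
    using le s by (intro mult_right_mono) auto
  also have "\<dots> = (\<Prod>i\<in>insert j I. (1 - p i) * (X i)\<^sup>2 + p i * (Y i)\<^sup>2)"
    using insert.hyps by simp
  finally have step: "((1 - s) * (prod X I)\<^sup>2 + s * Z\<^sup>2) * ((1 - p j) * (X j)\<^sup>2 + p j * (Y j)\<^sup>2)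
      \<le> (\<Prod>i\<in>insert j I. (1 - p i) * (X i)\<^sup>2 + p i * (Y i)\<^sup>2)" .
  have X: "prod X (insert j I) = prod X I * X j"
    using insert.hyps by simp
  show ?case
  proof (cases "s + p j > 0")
    case True
    let ?Z = "(s * Z * X j + p j * prod X I * Y j) / (s + p j)"
    have "(s + p j) * ?Z = s * Z * X j + p j * prod X I * Y j"
      using True by simp
    moreover have "(1 - (s + p j)) * (prod X I * X j)\<^sup>2 + (s + p j) * ?Z\<^sup>2
        \<le> (\<Prod>i\<in>insert j I. (1 - p i) * (X i)\<^sup>2 + p i * (Y i)\<^sup>2)"
      using weighted_merge[OF s True, of "prod X I" "X j" Z "Y j"] step by linarith
    ultimately show ?thesis
      unfolding sum P X by blast
  next
    case False
    then have "s = 0" "p j = 0" using s by auto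
    then show ?thesis
      unfolding sum P X using step by (simp add: power_mult_distrib)
  qed
qed

text \<open>Convexity of the square, with weights \<open>1 - sum p I\<close> and
  \<open>sum p I\<close>, turns the strong version into this one.\<close>

lemma weighted_product_inequality:
  fixes p X Y :: "'i \<Rightarrow> real"
  assumes "finite I" "\<And>i. i \<in> I \<Longrightarrow> p i \<ge> 0" "sum p I \<le> 1"
  shows "((1 - sum p I) * prod X I + (\<Sum>i\<in>I. p i * Y i * prod X (I - {i})))\<^sup>2
    \<le> (\<Prod>i\<in>I. (1 - p i) * (X i)\<^sup>2 + p i * (Y i)\<^sup>2)"
proof -
  define s where "s = sum p I"
  obtain Z where Z: "s * Z = (\<Sum>i\<in>I. p i * Y i * prod X (I - {i}))"
    and le: "(1 - s) * (prod X I)\<^sup>2 + s * Z\<^sup>2 \<le> (\<Prod>i\<in>I. (1 - p i) * (X i)\<^sup>2 + p i * (Y i)\<^sup>2)"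
    using weighted_product_inequality_strong[OF assms] unfolding s_def by blast
  have "(1 - s) * (prod X I)\<^sup>2 + s * Z\<^sup>2 - ((1 - s) * prod X I + s * Z)\<^sup>2
      = s * (1 - s) * (prod X I - Z)\<^sup>2"
    by algebra
  also have "\<dots> \<ge> 0"
    using assms by (simp add: s_def sum_nonneg)
  finally show ?thesis
    using le Z unfolding s_def by simp
qed

section \<open>From the torus to arbitrary rows\<close>

text \<open>Positive definiteness of \<open>E\<close> is dropped by adding a small multiple of the
  identity and letting it tend to zero, the determinant being a polynomial in the entries.\<close>

lemma row_form_le:
  fixes A B E :: "real^'n^'n"
  assumes E: "det_increasing E" and c: "c \<ge> 0"
    and torus: "\<And>x y. (\<And>i. (x i)\<^sup>2 + (y i)\<^sup>2 = 1) \<Longrightarrow>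
       \<bar>\<alpha> * prod x UNIV + (\<Sum>i\<in>UNIV. \<beta> i * (y i * prod x (UNIV - {i})))\<bar> \<le> c"
  shows "(row_form \<alpha> \<beta> A B)\<^sup>2 \<le> c\<^sup>2 * det (E + (\<Sum>i\<in>UNIV. outer (A $ i) + outer (B $ i)))"
proof -
  define G where "G = E + (\<Sum>i\<in>UNIV. outer (A $ i) + outer (B $ i))"
  have "((\<lambda>\<epsilon>. c\<^sup>2 * det (mat \<epsilon> + G)) \<longlongrightarrow> c\<^sup>2 * det (mat 0 + G)) (at_right 0)"
    unfolding det_def mat_def plus_vec_def vec_lambda_beta
  proof (intro tendsto_intros)
    show "((\<lambda>\<epsilon>. if i = j then \<epsilon> else 0) \<longlongrightarrow> (if i = j then 0 else 0)) (at_right 0)" for i j :: 'n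
      by (cases "i = j") (auto intro!: tendsto_intros)
  qed
  moreover have "(row_form \<alpha> \<beta> A B)\<^sup>2 \<le> c\<^sup>2 * det (mat \<epsilon> + G)" if "\<epsilon> > 0" for \<epsilon>
  proof -
    have "pos_def (mat \<epsilon> + E)"
      using pos_def_mat[OF that] E by (auto simp: det_increasing_def)
    moreover have "det_increasing (mat \<epsilon> + E)"
      using that by (intro det_increasing_add det_increasing_mat E) auto
    ultimately show ?thesis
      using row_form_le_pos_def[OF _ _ c torus, of "mat \<epsilon> + E" UNIV A B]
      by (simp add: G_def add.assoc)
  qed
  then have "eventually (\<lambda>\<epsilon>. (row_form \<alpha> \<beta> A B)\<^sup>2 \<le> c\<^sup>2 * det (mat \<epsilon> + G)) (at_right 0)"
    by (auto simp: eventually_at_right_less intro: eventually_mono[OF eventually_at_right_less[of 0]])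
  ultimately have "(row_form \<alpha> \<beta> A B)\<^sup>2 \<le> c\<^sup>2 * det (mat 0 + G)"
    by (intro tendsto_lowerbound) auto
  moreover have "mat 0 + G = G"
    by (simp add: mat_def vec_eq_iff)
  ultimately show ?thesis
    by (simp add: G_def)
qed

text \<open>After rescaling by \<open>q i\<close>, this is the weighted product inequality in which
  each factor on the right becomes \<open>(x i)\<^sup>2 + (y i)\<^sup>2\<close>, or just
  \<open>(x i)\<^sup>2\<close> if \<open>l i = 0\<close>.\<close>

lemma torus_bound:
  fixes l x y :: "'n::finite \<Rightarrow> real"
  assumes S: "(\<Sum>i\<in>UNIV. (l i)\<^sup>2 / (1 + (l i)\<^sup>2)) \<le> 1" and xy: "\<And>i. (x i)\<^sup>2 + (y i)\<^sup>2 = 1"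
  shows "\<bar>sqrt (\<Prod>i\<in>UNIV. 1 + (l i)\<^sup>2) * (1 - (\<Sum>i\<in>UNIV. (l i)\<^sup>2 / (1 + (l i)\<^sup>2))) * prod x UNIV
    + (\<Sum>i\<in>UNIV. sqrt (\<Prod>i\<in>UNIV. 1 + (l i)\<^sup>2) * (l i / (1 + (l i)\<^sup>2)) * (y i * prod x (UNIV - {i})))\<bar> \<le> 1"
proof -
  define p where "p i = (l i)\<^sup>2 / (1 + (l i)\<^sup>2)" for i
  define q where "q i = sqrt (1 + (l i)\<^sup>2)" for i
  define X where "X i = q i * x i" for i
  \<comment> \<open>For \<open>l i = 0\<close> division by zero gives \<open>Y i = 0\<close>, which
    is harmless because the weight \<open>p i\<close> is zero too.\<close>
  define Y where "Y i = q i * y i / l i" for i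
  have pos: "1 + (l i)\<^sup>2 > 0" for i
    by (simp add: add_pos_nonneg)
  have q: "(q i)\<^sup>2 = 1 + (l i)\<^sup>2" for i
    using pos[of i] by (simp add: q_def)
  have C: "sqrt (\<Prod>i\<in>UNIV. 1 + (l i)\<^sup>2) = prod q UNIV"
    by (rule real_sqrt_unique) (simp_all add: prod_power_distrib q, simp add: q_def prod_nonneg)
  have "p i * Y i * prod X (UNIV - {i}) = prod q UNIV * (l i / (1 + (l i)\<^sup>2)) * (y i * prod x (UNIV - {i}))" for i
  proof -
    have "p i * Y i = q i * (l i / (1 + (l i)\<^sup>2)) * y i"
      by (cases "l i = 0") (simp_all add: p_def Y_def power2_eq_square)
    moreover have "prod q UNIV = q i * prod q (UNIV - {i})"
      by (rule prod.remove) auto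
    ultimately show ?thesis
      by (simp add: X_def prod.distrib)
  qed
  moreover have "(1 - p i) * (X i)\<^sup>2 + p i * (Y i)\<^sup>2 \<in> {0..1}" for i
  proof -
    have "1 - p i = 1 / (1 + (l i)\<^sup>2)"
      using pos[of i] by (simp add: p_def field_simps)
    then have "(1 - p i) * (X i)\<^sup>2 = (x i)\<^sup>2"
      using pos[of i] by (simp add: X_def power_mult_distrib q)
    moreover have "p i * (Y i)\<^sup>2 = (if l i = 0 then 0 else (y i)\<^sup>2)"
      using pos[of i] by (auto simp: p_def Y_def power_mult_distrib power_divide q)
    ultimately show ?thesis
      using xy[of i] by (auto simp: sum_squares_le_zero_iff) (smt (verit) zero_le_power2)+
  qed
  then have "(\<Prod>i\<in>UNIV. (1 - p i) * (X i)\<^sup>2 + p i * (Y i)\<^sup>2) \<le> 1"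
    by (intro prod_le_1) auto
  moreover have "((1 - sum p UNIV) * prod X UNIV + (\<Sum>i\<in>UNIV. p i * Y i * prod X (UNIV - {i})))\<^sup>2
    \<le> (\<Prod>i\<in>UNIV. (1 - p i) * (X i)\<^sup>2 + p i * (Y i)\<^sup>2)"
    using S by (intro weighted_product_inequality) (auto simp: p_def)
  ultimately have "(prod q UNIV * (1 - sum p UNIV) * prod x UNIV
      + (\<Sum>i\<in>UNIV. prod q UNIV * (l i / (1 + (l i)\<^sup>2)) * (y i * prod x (UNIV - {i}))))\<^sup>2 \<le> 1"
    by (simp add: X_def prod.distrib mult_ac)
  then show ?thesis
    unfolding C p_def abs_square_le_1 by simp
qed

text \<open>Serves for singular values with sum above 1, where some finite bound is still needed for
  the supremum in the comass to be meaningful.\<close>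

lemma torus_bound_crude:
  fixes x y :: "'n::finite \<Rightarrow> real"
  assumes "\<And>i. (x i)\<^sup>2 + (y i)\<^sup>2 = 1"
  shows "\<bar>\<alpha> * prod x UNIV + (\<Sum>i\<in>UNIV. \<beta> i * (y i * prod x (UNIV - {i})))\<bar> \<le> \<bar>\<alpha>\<bar> + (\<Sum>i\<in>UNIV. \<bar>\<beta> i\<bar>)"
proof -
  have "(x i)\<^sup>2 \<le> 1" "(y i)\<^sup>2 \<le> 1" for i
    using assms[of i] by (smt (verit) zero_le_power2)+
  then have x: "\<bar>x i\<bar> \<le> 1" and y: "\<bar>y i\<bar> \<le> 1" for i
    by (simp_all add: abs_square_le_1)
  have px: "\<bar>prod x I\<bar> \<le> 1" for I
    by (simp add: abs_prod prod_le_1 x)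
  have "\<bar>y i * prod x (UNIV - {i})\<bar> \<le> 1" for i
    using mult_mono[OF y px] by (simp add: abs_mult)
  then have "\<bar>\<beta> i * (y i * prod x (UNIV - {i}))\<bar> \<le> \<bar>\<beta> i\<bar>" for i
    by (subst abs_mult) (simp add: mult_left_le)
  then have "\<bar>\<Sum>i\<in>UNIV. \<beta> i * (y i * prod x (UNIV - {i}))\<bar> \<le> (\<Sum>i\<in>UNIV. \<bar>\<beta> i\<bar>)"
    by (intro order_trans[OF sum_abs] sum_mono)
  moreover have "\<bar>\<alpha> * prod x UNIV\<bar> \<le> \<bar>\<alpha>\<bar>"
    using px by (simp add: abs_mult mult_left_le)
  ultimately show ?thesis by linarith
qed

section \<open>Wedge products as determinants\<close>

text \<open>Conjugating permutations by \<open>\<mu>\<close> preserves their sign. As rows and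
  columns are reindexed together, any enumeration serves, whatever the orientation
  \<open>\<nu>\<close>.\<close>

lemma wedge_eq_det:
  fixes \<mu> :: "'n::finite \<Rightarrow> nat"
  assumes \<mu>: "bij_betw \<mu> UNIV {..<length \<alpha>s}"
  shows "wedge \<alpha>s vs = det (\<chi> i j. (\<alpha>s ! \<mu> i) (vs ! \<mu> j))"
proof -
  let ?P = "map_permutation UNIV \<mu>" and ?Q = "map_permutation {..<length \<alpha>s} (inv_into UNIV \<mu>)"
  have inj: "inj \<mu>" using \<mu> by (simp add: bij_betw_def)
  have inv: "bij_betw (inv_into UNIV \<mu>) {..<length \<alpha>s} UNIV"
    by (rule bij_betw_inv_into[OF \<mu>])
  have "det (\<chi> i j. (\<alpha>s ! \<mu> i) (vs ! \<mu> j))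
      = (\<Sum>p | p permutes UNIV. of_int (sign p) * (\<Prod>i\<in>UNIV. (\<alpha>s ! \<mu> i) (vs ! \<mu> (p i))))"
    by (simp add: det_def)
  also have "\<dots> = (\<Sum>\<sigma> | \<sigma> permutes {..<length \<alpha>s}.
      of_int (sign \<sigma>) * (\<Prod>k<length \<alpha>s. (\<alpha>s ! k) (vs ! \<sigma> k)))"
  proof (rule sum.reindex_bij_witness[of _ ?Q ?P])
    fix p :: "'n \<Rightarrow> 'n" assume "p \<in> {p. p permutes UNIV}"
    then have p: "p permutes UNIV" by simp
    show "?Q (?P p) = p"
      by (rule map_permutation_compose_inv[OF \<mu> p]) (simp add: inj)
    show "?P p \<in> {\<sigma>. \<sigma> permutes {..<length \<alpha>s}}"
      using map_permutation_permutes[OF \<mu> p] by simp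
    have "(\<Prod>k<length \<alpha>s. (\<alpha>s ! k) (vs ! ?P p k)) = (\<Prod>i\<in>UNIV. (\<alpha>s ! \<mu> i) (vs ! ?P p (\<mu> i)))"
      by (rule prod.reindex_bij_betw[OF \<mu>, symmetric])
    then show "of_int (sign (?P p)) * (\<Prod>k<length \<alpha>s. (\<alpha>s ! k) (vs ! ?P p k))
        = of_int (sign p) * (\<Prod>i\<in>UNIV. (\<alpha>s ! \<mu> i) (vs ! \<mu> (p i)))"
      by (simp add: sign_map_permutation[OF inj p] map_permutation_apply[OF inj])
  next
    fix \<sigma> assume "\<sigma> \<in> {\<sigma>. \<sigma> permutes {..<length \<alpha>s}}"
    then have \<sigma>: "\<sigma> permutes {..<length \<alpha>s}" by simp
    show "?P (?Q \<sigma>) = \<sigma>"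
      by (rule map_permutation_compose_inv[OF inv \<sigma>]) (use bij_betw_inv_into_right[OF \<mu>] in auto)
    show "?Q \<sigma> \<in> {p. p permutes UNIV}"
      using map_permutation_permutes[OF inv \<sigma>] by simp
  qed
  finally show ?thesis
    by (simp add: wedge_def)
qed

lemma wedge_swap:
  "wedge (\<delta>s @ \<alpha> # \<beta> # \<gamma>s) vs = - wedge (\<delta>s @ \<beta> # \<alpha> # \<gamma>s) vs"
proof -
  define \<phi> where "\<phi> = \<delta>s @ \<alpha> # \<beta> # \<gamma>s"
  define \<psi> where "\<psi> = \<delta>s @ \<beta> # \<alpha> # \<gamma>s"
  define n where "n = length \<phi>"
  define k where "k = length \<delta>s"
  define \<tau> where "\<tau> = Transposition.transpose k (Suc k)"
  have len: "length \<psi> = n" "length \<phi> = n" by (simp_all add: n_def \<phi>_def \<psi>_def)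
  have \<tau>: "\<tau> permutes {..<n}"
    unfolding \<tau>_def by (rule permutes_swap_id) (auto simp: n_def k_def \<phi>_def)
  have \<tau>\<tau>: "\<tau> (\<tau> m) = m" for m
    by (simp add: \<tau>_def)
  have nth: "\<phi> ! \<tau> m = \<psi> ! m" for m
    by (auto simp: \<tau>_def \<phi>_def \<psi>_def k_def Transposition.transpose_def nth_append nth_Cons split: nat.split)
  have sign: "sign (\<sigma> \<circ> \<tau>) = - sign \<sigma>" if "\<sigma> permutes {..<n}" for \<sigma>
    using that \<tau> by (subst sign_compose) (auto simp: permutation_permutes \<tau>_def sign_swap_id intro: exI[of _ "{..<n}"])
  have "wedge \<phi> vs = (\<Sum>\<sigma> | \<sigma> permutes {..<n}. of_int (sign (\<sigma> \<circ> \<tau>)) * (\<Prod>m<n. (\<phi> ! m) (vs ! (\<sigma> \<circ> \<tau>) m)))"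
    unfolding wedge_def len by (rule sum_permutations_compose_right[OF \<tau>])
  also have "\<dots> = (\<Sum>\<sigma> | \<sigma> permutes {..<n}. - (of_int (sign \<sigma>) * (\<Prod>m<n. (\<psi> ! m) (vs ! \<sigma> m))))"
  proof (rule sum.cong)
    fix \<sigma> assume "\<sigma> \<in> {\<sigma>. \<sigma> permutes {..<n}}"
    moreover have "(\<Prod>m<n. (\<phi> ! m) (vs ! (\<sigma> \<circ> \<tau>) m)) = (\<Prod>m<n. (\<phi> ! \<tau> m) (vs ! (\<sigma> \<circ> \<tau>) (\<tau> m)))"
      using prod.permute[OF \<tau>, of "\<lambda>m. (\<phi> ! m) (vs ! (\<sigma> \<circ> \<tau>) m)"] by (simp add: o_def)
    ultimately show "of_int (sign (\<sigma> \<circ> \<tau>)) * (\<Prod>m<n. (\<phi> ! m) (vs ! (\<sigma> \<circ> \<tau>) m))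
        = - (of_int (sign \<sigma>) * (\<Prod>m<n. (\<psi> ! m) (vs ! \<sigma> m)))"
      by (simp add: sign nth \<tau>\<tau>)
  qed simp
  finally show ?thesis
    unfolding \<phi>_def[symmetric] \<psi>_def[symmetric] by (simp add: wedge_def len sum_negf)
qed

text \<open>Iterated adjacent swaps; this accounts for the alternating signs in the definition of
  the form.\<close>

lemma wedge_move:
  "wedge (\<delta>s @ \<alpha> # \<beta>s @ \<gamma>s) vs = (-1) ^ length \<beta>s * wedge (\<delta>s @ \<beta>s @ \<alpha> # \<gamma>s) vs"
proof (induction \<beta>s arbitrary: \<delta>s)
  case (Cons \<beta> \<beta>s)
  show ?case
    using Cons[of "\<delta>s @ [\<beta>]"] wedge_swap[of \<delta>s \<alpha> \<beta> "\<beta>s @ \<gamma>s" vs] by simp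
qed simp

lemma obtain_index_bijection:
  obtains \<mu> :: "'n::finite \<Rightarrow> nat" where "bij_betw \<mu> UNIV {..<CARD('n)}"
  using ex_bij_betw_finite_nat[of "UNIV :: 'n set"] by (auto simp: atLeast0LessThan)

lemma sum_index_Suc:
  fixes \<mu> :: "'n::finite \<Rightarrow> nat" and g :: "nat \<Rightarrow> real"
  assumes "bij_betw \<mu> UNIV {..<CARD('n)}"
  shows "(\<Sum>i=1..CARD('n). g i) = (\<Sum>k\<in>UNIV. g (Suc (\<mu> k)))"
proof -
  have "(\<Sum>i=1..CARD('n). g i) = (\<Sum>i<CARD('n). g (Suc i))"
    by (simp add: sum.atLeast1_atMost_eq)
  also have "\<dots> = (\<Sum>k\<in>UNIV. g (Suc (\<mu> k)))"
    by (rule sum.reindex_bij_betw[OF assms, symmetric])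
  finally show ?thesis .
qed

lemma prod_index_Suc:
  fixes \<mu> :: "'n::finite \<Rightarrow> nat" and g :: "nat \<Rightarrow> real"
  assumes "bij_betw \<mu> UNIV {..<CARD('n)}"
  shows "(\<Prod>i=1..CARD('n). g i) = (\<Prod>k\<in>UNIV. g (Suc (\<mu> k)))"
proof -
  have "(\<Prod>i=1..CARD('n). g i) = (\<Prod>i<CARD('n). g (Suc i))"
    by (simp add: prod.atLeast1_atMost_eq)
  also have "\<dots> = (\<Prod>k\<in>UNIV. g (Suc (\<mu> k)))"
    by (rule prod.reindex_bij_betw[OF assms, symmetric])
  finally show ?thesis .
qed

section \<open>Orthonormal bases\<close>

lemma orthonormal_family_matrix:
  fixes e :: "nat \<Rightarrow> real^'n"
  assumes e: "orthonormal_family CARD('n) e" and \<mu>: "bij_betw \<mu> (UNIV :: 'n set) {..<CARD('n)}"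
  defines "Q \<equiv> (\<chi> i j. e (Suc (\<mu> i)) $ j)"
  shows "transpose Q ** Q = mat 1"
proof -
  have "\<mu> i < CARD('n)" for i
    using \<mu> by (auto simp: bij_betw_def)
  then have "e (Suc (\<mu> i)) \<bullet> e (Suc (\<mu> j)) = (if i = j then 1 else 0)" for i j
    using e \<mu> by (auto simp: orthonormal_family_def Suc_le_eq bij_betw_def inj_eq)
  then have "Q ** transpose Q = mat 1"
    by (simp add: Q_def matrix_matrix_mult_def transpose_def mat_def vec_eq_iff inner_vec_def)
  then show ?thesis
    by (simp add: matrix_left_right_inverse)
qed

lemma orthonormal_family_parseval:
  fixes e :: "nat \<Rightarrow> real^'n"
  assumes e: "orthonormal_family CARD('n) e"
  shows "u \<bullet> v = (\<Sum>i=1..CARD('n). (e i \<bullet> u) * (e i \<bullet> v))"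
proof -
  obtain \<mu> :: "'n \<Rightarrow> nat" where \<mu>: "bij_betw \<mu> UNIV {..<CARD('n)}"
    by (rule obtain_index_bijection)
  define Q where "Q = (\<chi> i j. e (Suc (\<mu> i)) $ j)"
  have Q: "(Q *v u) $ i = e (Suc (\<mu> i)) \<bullet> u" for u i
    by (simp add: Q_def matrix_vector_mult_def inner_vec_def)
  have "u \<bullet> v = u \<bullet> ((transpose Q ** Q) *v v)"
    using orthonormal_family_matrix[OF e \<mu>] by (simp add: Q_def)
  also have "\<dots> = (Q *v u) \<bullet> (Q *v v)"
    by (metis dot_lmul_matrix matrix_vector_mul_assoc transpose_matrix_vector transpose_transpose)
  also have "\<dots> = (\<Sum>k\<in>UNIV. (e (Suc (\<mu> k)) \<bullet> u) * (e (Suc (\<mu> k)) \<bullet> v))"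
    by (simp add: inner_vec_def[of "Q *v u"] Q)
  finally show ?thesis
    unfolding sum_index_Suc[OF \<mu>] .
qed

lemma orthonormal_family_expansion:
  fixes e :: "nat \<Rightarrow> real^'n"
  assumes e: "orthonormal_family CARD('n) e"
  shows "v = (\<Sum>i=1..CARD('n). (e i \<bullet> v) *\<^sub>R e i)"
proof (rule vector_eq_rdot[THEN iffD1], rule allI)
  fix u
  show "v \<bullet> u = (\<Sum>i=1..CARD('n). (e i \<bullet> v) *\<^sub>R e i) \<bullet> u"
    by (simp add: orthonormal_family_parseval[OF e, of v u] inner_sum_left)
qed

section \<open>Singular value decompositions\<close>

text \<open>The values of \<open>lam\<close> beyond \<open>r\<close> are junk.\<close>

definition pad :: "nat \<Rightarrow> (nat \<Rightarrow> real) \<Rightarrow> nat \<Rightarrow> real" where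
  "pad r lam i = (if i \<le> r then lam i else 0)"

lemma sum_pad:
  fixes g :: "real \<Rightarrow> nat \<Rightarrow> real"
  assumes "r \<le> n" "\<And>i. g 0 i = 0"
  shows "(\<Sum>i=1..r. g (lam i) i) = (\<Sum>i=1..n. g (pad r lam i) i)"
  by (rule sum.mono_neutral_cong_left) (use assms in \<open>auto simp: pad_def\<close>)

lemma S_sum_index:
  fixes \<mu> :: "'n::finite \<Rightarrow> nat"
  assumes "bij_betw \<mu> UNIV {..<CARD('n)}" "r \<le> CARD('n)"
  shows "S_sum r lam = (\<Sum>k\<in>UNIV. (pad r lam (Suc (\<mu> k)))\<^sup>2 / (1 + (pad r lam (Suc (\<mu> k)))\<^sup>2))"
  using sum_pad[OF assms(2), of "\<lambda>s i. s\<^sup>2 / (1 + s\<^sup>2)" lam]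
    sum_index_Suc[OF assms(1), of "\<lambda>i. (pad r lam i)\<^sup>2 / (1 + (pad r lam i)\<^sup>2)"]
  by (simp only: S_sum_def power_zero_numeral div_0)

text \<open>Beyond \<open>r\<close> the padded value is zero, so it does not matter that
  \<open>f i\<close> may be outside the orthonormal family there.\<close>

lemma svd_image:
  fixes L :: "real^'n \<Rightarrow> real^'m"
  assumes "is_svd L e f r lam" "i \<in> {1..CARD('n)}"
  shows "L (e i) = pad r lam i *\<^sub>R f i"
  using assms by (auto simp: is_svd_def pad_def)

lemma svd_image_inner:
  fixes L :: "real^'n \<Rightarrow> real^'m"
  assumes svd: "is_svd L e f r lam" and "i \<in> {1..CARD('n)}" "j \<in> {1..CARD('n)}"
  shows "L (e i) \<bullet> L (e j) = (if i = j then (pad r lam i)\<^sup>2 else 0)"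
proof (cases "i \<le> r \<and> j \<le> r")
  case True
  then have "f i \<bullet> f j = (if i = j then 1 else 0)"
    using assms by (auto simp: is_svd_def orthonormal_family_def)
  then show ?thesis
    using assms by (simp add: svd_image[OF svd] power2_eq_square)
next
  case False
  then show ?thesis
    using assms by (auto simp: svd_image[OF svd] pad_def)
qed

text \<open>Says without an adjoint that \<open>e i\<close> is an eigenvector of the transpose of
  \<open>L\<close> composed with \<open>L\<close>.\<close>

lemma svd_image_inner_arbitrary:
  fixes L :: "real^'n \<Rightarrow> real^'m"
  assumes svd: "is_svd L e f r lam" and L: "linear L" and i: "i \<in> {1..CARD('n)}"
  shows "L (e i) \<bullet> L v = (pad r lam i)\<^sup>2 * (e i \<bullet> v)"
proof -
  have e: "orthonormal_family CARD('n) e"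
    using svd by (simp add: is_svd_def)
  have "L v = (\<Sum>j=1..CARD('n). (e j \<bullet> v) *\<^sub>R L (e j))"
    by (subst orthonormal_family_expansion[OF e, of v]) (simp add: linear_sum[OF L] linear_cmul[OF L])
  then have "L (e i) \<bullet> L v = (\<Sum>j=1..CARD('n). (e j \<bullet> v) * (L (e i) \<bullet> L (e j)))"
    by (simp add: inner_sum_right)
  also have "\<dots> = (\<Sum>j=1..CARD('n). if i = j then (e j \<bullet> v) * (pad r lam i)\<^sup>2 else 0)"
    by (rule sum.cong) (use svd_image_inner[OF svd i] in auto)
  finally show ?thesis
    using i by simp
qed

text \<open>Eigenvectors of \<open>L\<^sup>T L\<close> with different eigenvalues are orthogonal, so only pairs of equal
  singular values contribute to the double sum of the squares \<open>(e i \<bullet> e' j)\<^sup>2\<close>.\<close>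

lemma S_sum_svd_unique:
  fixes L :: "real^'n \<Rightarrow> real^'m"
  assumes svd: "is_svd L e f r lam" and svd': "is_svd L e' f' r' lam'" and L: "linear L"
  shows "S_sum r lam = S_sum r' lam'"
proof -
  let ?N = "{1..CARD('n)}"
  define g where "g s = s / (1 + s)" for s :: real
  define a where "a i = (pad r lam i)\<^sup>2" for i
  define a' where "a' i = (pad r' lam' i)\<^sup>2" for i
  have e: "orthonormal_family CARD('n) e" "orthonormal_family CARD('n) e'" "r \<le> CARD('n)" "r' \<le> CARD('n)"
    using svd svd' by (simp_all add: is_svd_def)
  have eig: "a i * (e i \<bullet> e' j) = a' j * (e i \<bullet> e' j)" if "i \<in> ?N" "j \<in> ?N" for i j
    using svd_image_inner_arbitrary[OF svd L that(1), of "e' j"]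
      svd_image_inner_arbitrary[OF svd' L that(2), of "e i"]
    by (simp add: a_def a'_def inner_commute)
  have eq: "g (a i) * (e i \<bullet> e' j)\<^sup>2 = g (a' j) * (e i \<bullet> e' j)\<^sup>2" if "i \<in> ?N" "j \<in> ?N" for i j
    using eig[OF that] by (cases "e i \<bullet> e' j = 0") simp_all
  have 1: "(\<Sum>j\<in>?N. (e i \<bullet> e' j)\<^sup>2) = 1" if "i \<in> ?N" for i
    using orthonormal_family_parseval[OF e(2), of "e i" "e i"] e(1) that
    by (simp add: orthonormal_family_def power2_eq_square inner_commute)
  have 2: "(\<Sum>i\<in>?N. (e i \<bullet> e' j)\<^sup>2) = 1" if "j \<in> ?N" for j
    using orthonormal_family_parseval[OF e(1), of "e' j" "e' j"] e(2) that
    by (simp add: orthonormal_family_def power2_eq_square)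
  have "S_sum r lam = (\<Sum>i\<in>?N. g (a i))"
    unfolding S_sum_def g_def a_def by (rule sum_pad[OF e(3)]) simp
  also have "\<dots> = (\<Sum>i\<in>?N. \<Sum>j\<in>?N. g (a i) * (e i \<bullet> e' j)\<^sup>2)"
    by (rule sum.cong) (simp_all only: 1 mult_1_right sum_distrib_left[symmetric])
  also have "\<dots> = (\<Sum>i\<in>?N. \<Sum>j\<in>?N. g (a' j) * (e i \<bullet> e' j)\<^sup>2)"
    by (intro sum.cong eq) auto
  also have "\<dots> = (\<Sum>j\<in>?N. \<Sum>i\<in>?N. g (a' j) * (e i \<bullet> e' j)\<^sup>2)"
    by (rule sum.swap)
  also have "\<dots> = (\<Sum>j\<in>?N. g (a' j))"
    by (rule sum.cong) (simp_all only: 2 mult_1_right sum_distrib_left[symmetric])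
  also have "\<dots> = S_sum r' lam'"
    unfolding S_sum_def g_def a'_def by (rule sum_pad[OF e(4), symmetric]) simp
  finally show ?thesis .
qed

text \<open>Changing the sign of \<open>e 1\<close> and \<open>f 1\<close> together keeps a singular
  value decomposition and reverses the orientation.\<close>

lemma positively_oriented_svd_exists:
  fixes L :: "real^'n \<Rightarrow> real^'m" and \<nu> :: "nat \<Rightarrow> 'n"
  assumes svd: "is_svd L e f r lam" and L: "linear L" and \<nu>: "bij_betw \<nu> {1..CARD('n)} UNIV"
  obtains e' f' where "is_svd L e' f' r lam" "positively_oriented \<nu> e'"
proof -
  obtain \<mu> :: "'n \<Rightarrow> nat" where \<mu>: "bij_betw \<mu> UNIV {..<CARD('n)}"
    by (rule obtain_index_bijection)
  have \<mu>_less: "\<mu> i < CARD('n)" for i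
    using \<mu> by (auto simp: bij_betw_def)
  have e: "orthonormal_family CARD('n) e"
    using svd by (simp add: is_svd_def)
  let ?W = "\<lambda>e. wedge (map (\<lambda>j v. v $ \<nu> j) [1..<Suc CARD('n)]) (map e [1..<Suc CARD('n)])"
  define M where "M e = (\<chi> j i. e (Suc (\<mu> j)) $ \<nu> (Suc (\<mu> i)) :: real^'n^'n)" for e :: "nat \<Rightarrow> real^'n"
  have W: "?W e = det (M e)" for e
  proof -
    have "?W e = det (\<chi> i j. e (Suc (\<mu> j)) $ \<nu> (Suc (\<mu> i)))"
      by (subst wedge_eq_det[of \<mu>]) (use \<mu> \<mu>_less in \<open>simp_all add: nth_append del: upt_Suc\<close>)
    also have "(\<chi> i j. e (Suc (\<mu> j)) $ \<nu> (Suc (\<mu> i))) = transpose (M e)"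
      by (simp add: M_def transpose_def)
    finally show ?thesis by simp
  qed
  \<comment> \<open>The two enumerations differ by a permutation, so up to sign the orientation
    determinant is that of the orthogonal matrix \<open>Q\<close>, hence nonzero.\<close>
  have "bij_betw (\<lambda>i. \<nu> (Suc (\<mu> i))) UNIV UNIV"
  proof -
    have "bij_betw Suc {..<CARD('n)} {1..CARD('n)}"
      by (simp add: bij_betw_def image_Suc_lessThan)
    from bij_betw_trans[OF bij_betw_trans[OF \<mu> this] \<nu>] show ?thesis
      by (simp add: o_def)
  qed
  then have p: "(\<lambda>i. \<nu> (Suc (\<mu> i))) permutes UNIV"
    by (rule bij_imp_permutes) simp
  define Q where "Q = (\<chi> i j. e (Suc (\<mu> i)) $ j)"
  have "M e = (\<chi> i j. Q $ i $ \<nu> (Suc (\<mu> j)))"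
    by (simp add: M_def Q_def)
  then have "det (M e) = of_int (sign (\<lambda>i. \<nu> (Suc (\<mu> i)))) * det Q"
    using det_permute_columns[OF p, of Q] by simp
  moreover have "det Q \<noteq> 0"
    using arg_cong[OF orthonormal_family_matrix[OF e \<mu>], of det]
    by (auto simp: det_mul Q_def)
  ultimately have nz: "?W e \<noteq> 0"
    unfolding W by simp
  show ?thesis
  proof (cases "?W e > 0")
    case True
    then show ?thesis
      using svd by (intro that) (auto simp: positively_oriented_def)
  next
    case False
    define e' where "e' = e(1 := - e 1)"
    define f' where "f' = f(1 := - f 1)"
    have "is_svd L e' f' r lam"
      using svd by (auto simp: is_svd_def orthonormal_family_def e'_def f'_def linear_neg[OF L])
    moreover
    obtain k where k: "\<mu> k = 0"
      using \<mu> by (auto simp: bij_betw_def image_iff set_eq_iff) (metis zero_less_card_finite)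
    have "M e' = replace_row k ((- 1) *\<^sub>R (M e $ k)) (M e)"
    proof -
      have "Suc (\<mu> i) = 1 \<longleftrightarrow> i = k" for i
        using k \<mu> by (metis One_nat_def UNIV_I Suc_inject bij_betw_imp_inj_on inj_onD)
      then show ?thesis
        using arg_cong[OF k, of "\<lambda>i. e (Suc i)"]
        by (auto simp: M_def e'_def replace_row_def vec_eq_iff)
    qed
    then have "?W e' = - ?W e"
      unfolding W using det_replace_row_scaleR[of k "- 1" "M e $ k" "M e"] by simp
    with nz False have "positively_oriented \<nu> e'"
      unfolding positively_oriented_def by linarith
    ultimately show ?thesis by (rule that)
  qed
qed

section \<open>Comass of the Tsai--Wang form\<close>

text \<open>Row \<open>k\<close> of both matrices belongs to the coordinates with index \<open>\<mu> k + 1\<close>, since \<open>\<mu>\<close> enumerates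
  \<open>'n\<close> from \<open>0\<close>, as list positions are counted.\<close>

definition dx_matrix ::
    "('n \<Rightarrow> nat) \<Rightarrow> (nat \<Rightarrow> real^'n) \<Rightarrow> ((real^'n) \<times> (real^'m)) list \<Rightarrow> real^'n^'n" where
  "dx_matrix \<mu> e vs = (\<chi> i j. dx e (Suc (\<mu> i)) (vs ! \<mu> j))"

definition dy_matrix ::
    "('n \<Rightarrow> nat) \<Rightarrow> nat \<Rightarrow> (nat \<Rightarrow> real^'m) \<Rightarrow> ((real^'n) \<times> (real^'m)) list \<Rightarrow> real^'n^'n" where
  "dy_matrix \<mu> r f vs = (\<chi> i j. if Suc (\<mu> i) \<le> r then dy f (Suc (\<mu> i)) (vs ! \<mu> j) else 0)"

lemma wedge_dx:
  fixes \<mu> :: "'n::finite \<Rightarrow> nat" and e :: "nat \<Rightarrow> real^'n" and vs :: "((real^'n) \<times> (real^'m)) list"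
  assumes \<mu>: "bij_betw \<mu> UNIV {..<CARD('n)}"
  shows "wedge (map (dx e) [1..<Suc CARD('n)]) vs = det (dx_matrix \<mu> e vs)"
proof -
  have "\<mu> i < CARD('n)" for i
    using \<mu> by (auto simp: bij_betw_def)
  then show ?thesis
    by (subst wedge_eq_det[of \<mu>]) (use \<mu> in \<open>simp_all add: dx_matrix_def del: upt_Suc\<close>)
qed

text \<open>Moving the dy-factor into position \<open>i\<close> passes \<open>i - 1\<close> factors,
  which cancels the sign in the form.\<close>

lemma wedge_dy_dx:
  fixes \<mu> :: "'n::finite \<Rightarrow> nat" and e :: "nat \<Rightarrow> real^'n" and vs :: "((real^'n) \<times> (real^'m)) list"
  assumes \<mu>: "bij_betw \<mu> UNIV {..<CARD('n)}" and i: "i = Suc (\<mu> k)" "i \<le> r"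
  shows "(-1) ^ (i - 1) * wedge (dy f i # map (dx e) ([1..<i] @ [Suc i..<Suc CARD('n)])) vs
    = det (replace_row k (dy_matrix \<mu> r f vs $ k) (dx_matrix \<mu> e vs))"
proof -
  have less: "\<mu> i < CARD('n)" for i
    using \<mu> by (auto simp: bij_betw_def)
  let ?L = "map (dx e) [1..<i] @ dy f i # map (dx e) [Suc i..<Suc CARD('n)] :: (_ \<Rightarrow> real) list"
  have "wedge (dy f i # map (dx e) ([1..<i] @ [Suc i..<Suc CARD('n)])) vs = (-1) ^ (i - 1) * wedge ?L vs"
    using wedge_move[of "[]" "dy f i" "map (dx e) [1..<i]"] by simp
  then have "(-1) ^ (i - 1) * wedge (dy f i # map (dx e) ([1..<i] @ [Suc i..<Suc CARD('n)])) vs = wedge ?L vs"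
    by (simp flip: power_mult_distrib mult.assoc)
  also have "\<dots> = det (\<chi> i j. (?L ! \<mu> i) (vs ! \<mu> j))"
  proof (rule wedge_eq_det)
    have "length ?L = CARD('n)"
      using i less[of k] by (simp del: upt_Suc)
    with \<mu> show "bij_betw \<mu> UNIV {..<length ?L}" by simp
  qed
  also have "(\<chi> i j. (?L ! \<mu> i) (vs ! \<mu> j)) = replace_row k (dy_matrix \<mu> r f vs $ k) (dx_matrix \<mu> e vs)"
  proof -
    have "?L ! \<mu> l = (if l = k then dy f i else dx e (Suc (\<mu> l)))" for l
    proof -
      have "\<mu> l = \<mu> k \<longleftrightarrow> l = k"
        using \<mu> by (auto simp: bij_betw_def inj_eq)
      then show ?thesis
        using less[of l] i by (auto simp: nth_append nth_Cons' simp del: upt_Suc)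
    qed
    then show ?thesis
      using i by (simp add: replace_row_def dx_matrix_def dy_matrix_def vec_eq_iff)
  qed
  finally show ?thesis .
qed

text \<open>Padding by zeros lets all sums and products run over the whole index type: a zero
  singular value contributes a factor 1 to \<open>C\<close> and nothing to the sums.\<close>

lemma tsai_wang_eq_row_form:
  fixes \<mu> :: "'n::finite \<Rightarrow> nat" and e :: "nat \<Rightarrow> real^'n" and vs :: "((real^'n) \<times> (real^'m)) list"
    and lam :: "nat \<Rightarrow> real"
  assumes \<mu>: "bij_betw \<mu> UNIV {..<CARD('n)}" and r: "r \<le> CARD('n)"
  defines "l \<equiv> \<lambda>k. pad r lam (Suc (\<mu> k))"
  defines "C \<equiv> sqrt (\<Prod>k\<in>UNIV. 1 + (l k)\<^sup>2)"
  shows "tsai_wang_in_coords e f r lam vs = row_form (C * (1 - (\<Sum>k\<in>UNIV. (l k)\<^sup>2 / (1 + (l k)\<^sup>2))))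
    (\<lambda>k. C * (l k / (1 + (l k)\<^sup>2))) (dx_matrix \<mu> e vs) (dy_matrix \<mu> r f vs)"
proof -
  have "(\<Prod>i=1..r. 1 + (lam i)\<^sup>2) = (\<Prod>i=1..CARD('n). 1 + (pad r lam i)\<^sup>2)"
    by (rule prod.mono_neutral_cong_left) (use r in \<open>auto simp: pad_def\<close>)
  then have C: "C_factor r lam = C"
    by (simp only: C_factor_def C_def l_def prod_index_Suc[OF \<mu>])
  have S: "S_sum r lam = (\<Sum>k\<in>UNIV. (l k)\<^sup>2 / (1 + (l k)\<^sup>2))"
    by (simp only: l_def S_sum_index[OF \<mu> r])
  let ?w = "\<lambda>i. (-1) ^ (i - 1) * wedge (dy f i # map (dx e) ([1..<i] @ [Suc i..<Suc CARD('n)])) vs"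
  have "(\<Sum>i=1..r. (-1) ^ (i - 1) * (lam i / (1 + (lam i)\<^sup>2)) *
           wedge (dy f i # map (dx e) ([1..<i] @ [Suc i..<Suc CARD('n)])) vs)
      = (\<Sum>i=1..r. lam i / (1 + (lam i)\<^sup>2) * ?w i)"
    by (simp add: mult_ac)
  also have "\<dots> = (\<Sum>i=1..CARD('n). pad r lam i / (1 + (pad r lam i)\<^sup>2) * ?w i)"
    by (rule sum_pad[OF r]) simp
  also have "\<dots> = (\<Sum>k\<in>UNIV. l k / (1 + (l k)\<^sup>2) * ?w (Suc (\<mu> k)))"
    unfolding l_def by (rule sum_index_Suc[OF \<mu>])
  also have "\<dots> = (\<Sum>k\<in>UNIV. l k / (1 + (l k)\<^sup>2) *
      det (replace_row k (dy_matrix \<mu> r f vs $ k) (dx_matrix \<mu> e vs)))"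
  proof (rule sum.cong)
    fix k :: 'n
    show "l k / (1 + (l k)\<^sup>2) * ?w (Suc (\<mu> k)) =
        l k / (1 + (l k)\<^sup>2) * det (replace_row k (dy_matrix \<mu> r f vs $ k) (dx_matrix \<mu> e vs))"
      using wedge_dy_dx[OF \<mu> refl, of k r f e vs]
      by (cases "Suc (\<mu> k) \<le> r") (simp_all add: l_def pad_def del: upt_Suc)
  qed simp
  finally show ?thesis
    unfolding tsai_wang_in_coords_def row_form_def C S wedge_dx[OF \<mu>]
    by (simp add: distrib_left sum_distrib_left mult.assoc)
qed

text \<open>Parseval in both bases writes the Gram matrix as a sum of rank-one squares, one for each
  coordinate.\<close>

lemma gram_eq_sum_outer:
  fixes \<mu> :: "'n::finite \<Rightarrow> nat" and e :: "nat \<Rightarrow> real^'n" and f :: "nat \<Rightarrow> real^'m"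
  assumes \<mu>: "bij_betw \<mu> UNIV {..<CARD('n)}"
    and e: "orthonormal_family CARD('n) e" and f: "orthonormal_family CARD('m) f"
    and r: "r \<le> CARD('n)" "r \<le> CARD('m)" and vs: "length vs = CARD('n)"
  obtains E where "det_increasing E"
    "wedge (map (\<bullet>) vs) vs =
       det (E + (\<Sum>i\<in>UNIV. outer (dx_matrix \<mu> e vs $ i) + outer (dy_matrix \<mu> r f vs $ i)))"
proof -
  \<comment> \<open>The y-coordinates beyond \<open>r\<close>, which do not occur in the form, are
    collected here.\<close>
  define E :: "real^'n^'n" where "E = (\<Sum>i\<in>{r<..CARD('m)}. outer (\<chi> j. dy f i (vs ! \<mu> j)))"
  let ?A = "dx_matrix \<mu> e vs" and ?B = "dy_matrix \<mu> r f vs"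
  have less: "\<mu> i < CARD('n)" for i
    using \<mu> by (auto simp: bij_betw_def)
  have "wedge (map (\<bullet>) vs) vs = det (\<chi> i j. vs ! \<mu> i \<bullet> vs ! \<mu> j)"
    by (subst wedge_eq_det[of \<mu>]) (use \<mu> vs less in simp_all)
  also have "(\<chi> i j. vs ! \<mu> i \<bullet> vs ! \<mu> j) = E + (\<Sum>i\<in>UNIV. outer (?A $ i) + outer (?B $ i))"
  proof -
    have "vs ! \<mu> i \<bullet> vs ! \<mu> j = (\<Sum>k\<in>{r<..CARD('m)}. dy f k (vs ! \<mu> i) * dy f k (vs ! \<mu> j))
        + (\<Sum>k\<in>UNIV. ?A $ k $ i * ?A $ k $ j + ?B $ k $ i * ?B $ k $ j)" for i j
    proof -
      have "vs ! \<mu> i \<bullet> vs ! \<mu> j = (\<Sum>k=1..CARD('n). dx e k (vs ! \<mu> i) * dx e k (vs ! \<mu> j))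
          + (\<Sum>k=1..CARD('m). dy f k (vs ! \<mu> i) * dy f k (vs ! \<mu> j))"
        unfolding inner_prod_def dx_def dy_def
        by (intro arg_cong2[of _ _ _ _ "(+)"] orthonormal_family_parseval e f)
      also have "(\<Sum>k=1..CARD('n). dx e k (vs ! \<mu> i) * dx e k (vs ! \<mu> j))
          = (\<Sum>k\<in>UNIV. ?A $ k $ i * ?A $ k $ j)"
        unfolding sum_index_Suc[OF \<mu>] by (simp add: dx_matrix_def)
      also have "(\<Sum>k=1..CARD('m). dy f k (vs ! \<mu> i) * dy f k (vs ! \<mu> j))
          = (\<Sum>k=1..r. dy f k (vs ! \<mu> i) * dy f k (vs ! \<mu> j))
            + (\<Sum>k\<in>{r<..CARD('m)}. dy f k (vs ! \<mu> i) * dy f k (vs ! \<mu> j))"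
        using r by (subst sum.union_disjoint[symmetric]) (auto intro!: sum.cong)
      also have "(\<Sum>k=1..r. dy f k (vs ! \<mu> i) * dy f k (vs ! \<mu> j))
          = (\<Sum>k=1..CARD('n). if k \<le> r then dy f k (vs ! \<mu> i) * dy f k (vs ! \<mu> j) else 0)"
        by (rule sum.mono_neutral_cong_left) (use r in auto)
      also have "\<dots> = (\<Sum>k\<in>UNIV. ?B $ k $ i * ?B $ k $ j)"
        unfolding sum_index_Suc[OF \<mu>] by (rule sum.cong) (auto simp: dy_matrix_def)
      finally show ?thesis
        by (simp add: sum.distrib)
    qed
    then show ?thesis
      by (simp add: vec_eq_iff E_def outer_def)
  qed
  finally show ?thesis
    by (intro that[of E]) (auto simp: E_def intro!: det_increasing_sum det_increasing_outer)
qed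

lemma tsai_wang_le:
  fixes e :: "nat \<Rightarrow> real^'n" and f :: "nat \<Rightarrow> real^'m"
  assumes svd: "is_svd L e f r lam"
  obtains c where
    "\<And>vs :: ((real^'n) \<times> (real^'m)) list. length vs = CARD('n) \<Longrightarrow> simple_vector_norm vs = 1 \<Longrightarrow>
       \<bar>tsai_wang_in_coords e f r lam vs\<bar> \<le> c"
    "S_sum r lam \<le> 1 \<Longrightarrow> c = 1"
proof -
  obtain \<mu> :: "'n \<Rightarrow> nat" where \<mu>: "bij_betw \<mu> UNIV {..<CARD('n)}"
    by (rule obtain_index_bijection)
  have e: "orthonormal_family CARD('n) e" "orthonormal_family CARD('m) f" "r \<le> CARD('n)" "r \<le> CARD('m)"
    using svd by (simp_all add: is_svd_def)
  define l where "l k = pad r lam (Suc (\<mu> k))" for k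
  define C where "C = sqrt (\<Prod>k\<in>UNIV. 1 + (l k)\<^sup>2)"
  define S where "S = (\<Sum>k\<in>UNIV. (l k)\<^sup>2 / (1 + (l k)\<^sup>2))"
  define \<beta> where "\<beta> k = C * (l k / (1 + (l k)\<^sup>2))" for k
  have S: "S_sum r lam = S"
    by (simp only: S_def l_def S_sum_index[OF \<mu> e(3)])
  define c where "c = (if S \<le> 1 then 1 else \<bar>C * (1 - S)\<bar> + (\<Sum>k\<in>UNIV. \<bar>\<beta> k\<bar>))"
  have c0: "c \<ge> 0"
    by (simp add: c_def sum_nonneg)
  have torus: "\<bar>C * (1 - S) * prod x UNIV + (\<Sum>i\<in>UNIV. \<beta> i * (y i * prod x (UNIV - {i})))\<bar> \<le> c"
    if "\<And>i. (x i)\<^sup>2 + (y i)\<^sup>2 = 1" for x y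
    using torus_bound[of l x y, OF _ that] torus_bound_crude[of x y "C * (1 - S)" \<beta>, OF that]
    by (auto simp: c_def C_def S_def \<beta>_def)
  have "\<bar>tsai_wang_in_coords e f r lam vs\<bar> \<le> c"
    if vs: "length vs = CARD('n)" "simple_vector_norm vs = 1" for vs :: "((real^'n) \<times> (real^'m)) list"
  proof -
    obtain E where E: "det_increasing E" and gram: "wedge (map (\<bullet>) vs) vs =
        det (E + (\<Sum>i\<in>UNIV. outer (dx_matrix \<mu> e vs $ i) + outer (dy_matrix \<mu> r f vs $ i)))"
      by (rule gram_eq_sum_outer[OF \<mu> e vs(1)])
    have "wedge (map (\<bullet>) vs) vs = 1"
      using vs(2) by (simp add: simple_vector_norm_def)
    with row_form_le[OF E c0 torus, of "dx_matrix \<mu> e vs" "dy_matrix \<mu> r f vs"] gram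
    have "(tsai_wang_in_coords e f r lam vs)\<^sup>2 \<le> c\<^sup>2"
      unfolding tsai_wang_eq_row_form[OF \<mu> e(3)] by (simp add: C_def S_def \<beta>_def l_def)
    then show ?thesis
      using c0 by (simp add: abs_le_square_iff[symmetric])
  qed
  moreover have "c = 1" if "S_sum r lam \<le> 1"
    using that by (simp add: c_def S)
  ultimately show ?thesis
    by (rule that)
qed

text \<open>For \<open>s = 1\<close> the plane is the tangent plane of the graph, for
  \<open>s = -1\<close> its reflection. The normalised vectors \<open>(e i, s * lam i * f i)\<close>
  are orthonormal, and on them the form reduces to its torus expression.\<close>

lemma tsai_wang_attained:
  fixes e :: "nat \<Rightarrow> real^'n" and f :: "nat \<Rightarrow> real^'m"
  assumes svd: "is_svd L e f r lam" and s: "s\<^sup>2 = 1"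
  obtains vs :: "((real^'n) \<times> (real^'m)) list" where "length vs = CARD('n)" "simple_vector_norm vs = 1"
    "tsai_wang_in_coords e f r lam vs = 1 - S_sum r lam + s * S_sum r lam"
proof -
  obtain \<mu> :: "'n \<Rightarrow> nat" where \<mu>: "bij_betw \<mu> UNIV {..<CARD('n)}"
    by (rule obtain_index_bijection)
  have less: "\<mu> i < CARD('n)" for i
    using \<mu> by (auto simp: bij_betw_def)
  have inj: "\<mu> i = \<mu> j \<longleftrightarrow> i = j" for i j
    using \<mu> by (auto simp: bij_betw_def inj_eq)
  have e: "orthonormal_family CARD('n) e" "orthonormal_family CARD('m) f" "r \<le> CARD('n)" "r \<le> CARD('m)"
    using svd by (simp_all add: is_svd_def)
  define l where "l k = pad r lam (Suc (\<mu> k))" for k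
  define C where "C = sqrt (\<Prod>k\<in>UNIV. 1 + (l k)\<^sup>2)"
  define S where "S = (\<Sum>k\<in>UNIV. (l k)\<^sup>2 / (1 + (l k)\<^sup>2))"
  have S: "S_sum r lam = S"
    by (simp only: S_def l_def S_sum_index[OF \<mu> e(3)])
  define x where "x k = 1 / sqrt (1 + (l k)\<^sup>2)" for k
  define y where "y k = s * l k * x k" for k
  have pos: "1 + (l k)\<^sup>2 > 0" for k
    by (simp add: add_pos_nonneg)
  have x2: "(1 + (l k)\<^sup>2) * (x k)\<^sup>2 = 1" for k
    using pos[of k] by (simp add: x_def power_divide)
  define vs where "vs = map (\<lambda>i. (1 / sqrt (1 + (pad r lam i)\<^sup>2)) *\<^sub>R (e i, (s * pad r lam i) *\<^sub>R f i))
    [1..<Suc CARD('n)]"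
  have len: "length vs = CARD('n)"
    by (simp add: vs_def)
  have vs: "vs ! \<mu> k = (x k *\<^sub>R e (Suc (\<mu> k)), y k *\<^sub>R f (Suc (\<mu> k)))" for k
    using less[of k] by (simp add: vs_def x_def y_def l_def nth_map del: upt_Suc)
  have ee: "e (Suc (\<mu> i)) \<bullet> e (Suc (\<mu> j)) = (if i = j then 1 else 0)" for i j
    using e(1) less[of i] less[of j] by (simp add: orthonormal_family_def inj)
  have ff: "f (Suc (\<mu> i)) \<bullet> f (Suc (\<mu> j)) = (if i = j then 1 else 0)"
    if "Suc (\<mu> i) \<le> r" "Suc (\<mu> j) \<le> r" for i j
    using e(2,4) that by (simp add: orthonormal_family_def inj)
  have y0: "y k = 0" if "\<not> Suc (\<mu> k) \<le> r" for k
    using that by (simp add: y_def l_def pad_def)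
  have yff: "y i * (y j * (f (Suc (\<mu> i)) \<bullet> f (Suc (\<mu> j)))) = (if i = j then (y i)\<^sup>2 else 0)" for i j
    using ff[of i j] y0[of i] y0[of j]
    by (cases "Suc (\<mu> i) \<le> r"; cases "Suc (\<mu> j) \<le> r") (auto simp: power2_eq_square)
  have xy: "(x k)\<^sup>2 + (y k)\<^sup>2 = 1" for k
    using x2[of k] s by (simp add: y_def power_mult_distrib distrib_right)
  have "vs ! \<mu> i \<bullet> vs ! \<mu> j = mat 1 $ i $ j" for i j
    using xy[of i] yff[of i j] by (auto simp: vs ee mat_def power2_eq_square mult_ac)
  then have "wedge (map (\<bullet>) vs) vs = det (mat 1 :: real^'n^'n)"
    by (subst wedge_eq_det[of \<mu>]) (use \<mu> len less in \<open>simp_all add: vec_lambda_eta\<close>)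
  then have norm: "simple_vector_norm vs = 1"
    by (simp add: simple_vector_norm_def)
  have A: "dx_matrix \<mu> e vs = (\<chi> i. x i *\<^sub>R (mat 1 :: real^'n^'n) $ i)"
    by (simp add: dx_matrix_def dx_def vs ee mat_def vec_eq_iff)
  have B: "dy_matrix \<mu> r f vs = (\<chi> i. y i *\<^sub>R (mat 1 :: real^'n^'n) $ i)"
  proof -
    have "y j * (f (Suc (\<mu> i)) \<bullet> f (Suc (\<mu> j))) = y i * (if i = j then 1 else 0)" if "Suc (\<mu> i) \<le> r" for i j
      using ff[of i j] y0[of j] that by (cases "Suc (\<mu> j) \<le> r") auto
    then show ?thesis
      using y0 by (simp add: dy_matrix_def dy_def vs mat_def vec_eq_iff)
  qed
  have Cx: "C * prod x UNIV = 1"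
  proof -
    have "C\<^sup>2 * (prod x UNIV)\<^sup>2 = (\<Prod>k\<in>UNIV. (1 + (l k)\<^sup>2) * (x k)\<^sup>2)"
      using pos by (simp add: C_def prod_power_distrib prod.distrib prod_nonneg less_imp_le)
    also have "\<dots> = 1" by (simp add: x2)
    finally have "(C * prod x UNIV)\<^sup>2 = 1" by (simp add: power_mult_distrib)
    moreover have "C * prod x UNIV \<ge> 0"
      using pos by (simp add: C_def x_def prod_nonneg less_imp_le)
    ultimately show ?thesis by (simp add: power2_eq_1_iff)
  qed
  \<comment> \<open>The factor \<open>x k\<close> contained in \<open>y k\<close> completes the
    punctured product, which then cancels against \<open>C\<close>.\<close>
  have summand: "C * (l k / (1 + (l k)\<^sup>2)) * (y k * prod x (UNIV - {k})) = s * ((l k)\<^sup>2 / (1 + (l k)\<^sup>2))" for k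
  proof -
    have "y k * prod x (UNIV - {k}) = s * l k * prod x UNIV"
      using prod.remove[of UNIV k x] by (simp add: y_def)
    then have "C * (l k / (1 + (l k)\<^sup>2)) * (y k * prod x (UNIV - {k}))
        = s * (l k * l k / (1 + (l k)\<^sup>2)) * (C * prod x UNIV)"
      by simp
    then show ?thesis
      by (simp only: Cx mult_1_right power2_eq_square)
  qed
  have "tsai_wang_in_coords e f r lam vs = C * (1 - S) * prod x UNIV
      + (\<Sum>k\<in>UNIV. C * (l k / (1 + (l k)\<^sup>2)) * (y k * prod x (UNIV - {k})))"
    by (simp only: tsai_wang_eq_row_form[OF \<mu> e(3)] A B row_form_product C_def S_def l_def
        det_I mult_1_right)
  also have "\<dots> = C * (1 - S) * prod x UNIV + s * S"
    by (simp only: summand S_def sum_distrib_left)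
  also have "\<dots> = 1 - S + s * S"
    using Cx by (simp add: mult.commute mult.left_commute)
  finally show ?thesis
    using len norm by (intro that) (simp_all add: S)
qed

lemma comass_tsai_wang_in_coords:
  fixes e :: "nat \<Rightarrow> real^'n" and f :: "nat \<Rightarrow> real^'m"
  assumes svd: "is_svd L e f r lam"
  shows "comass CARD('n) (tsai_wang_in_coords e f r lam :: ((real^'n) \<times> (real^'m)) list \<Rightarrow> real) = 1
    \<longleftrightarrow> S_sum r lam \<le> 1"
proof -
  let ?\<omega> = "tsai_wang_in_coords e f r lam :: ((real^'n) \<times> (real^'m)) list \<Rightarrow> real"
  let ?V = "{\<bar>?\<omega> vs\<bar> |vs. length vs = CARD('n) \<and> simple_vector_norm vs = 1}"
  obtain c where "\<And>vs :: ((real^'n) \<times> (real^'m)) list. length vs = CARD('n) \<Longrightarrow>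
      simple_vector_norm vs = 1 \<Longrightarrow> \<bar>?\<omega> vs\<bar> \<le> c" and c1: "S_sum r lam \<le> 1 \<Longrightarrow> c = 1"
    by (rule tsai_wang_le[OF svd]) blast
  then have c: "a \<le> c" if "a \<in> ?V" for a
    using that by blast
  have bdd: "bdd_above ?V"
    using c by (rule bdd_aboveI)
  have attained: "\<bar>1 - S_sum r lam + s * S_sum r lam\<bar> \<in> ?V" if "s\<^sup>2 = 1" for s
    by (rule tsai_wang_attained[OF svd that]) force
  show ?thesis
  proof
    assume le: "S_sum r lam \<le> 1"
    have "1 \<in> ?V" using attained[of 1] by simp
    then show "comass CARD('n) ?\<omega> = 1"
      unfolding comass_def using c c1[OF le] by (intro cSup_eq_maximum) auto
  next
    assume *: "comass CARD('n) ?\<omega> = 1"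
    \<comment> \<open>The reflected plane, \<open>s = -1\<close>, forces
      \<open>\<bar>1 - 2 * S_sum r lam\<bar>\<close> to be at most 1.\<close>
    have "\<bar>1 - S_sum r lam + (- 1) * S_sum r lam\<bar> \<le> comass CARD('n) ?\<omega>"
      unfolding comass_def by (rule cSup_upper[OF attained bdd]) simp
    with * show "S_sum r lam \<le> 1" by linarith
  qed
qed

theorem theorem1p1:
  fixes D :: "(real^'n) set" and F :: "real^'n \<Rightarrow> real^'m" and \<nu> :: "nat \<Rightarrow> 'n"
    and p :: "(real^'n) \<times> (real^'m)" and x :: "real^'n" and y :: "real^'m"
    and r :: nat and lam :: "nat \<Rightarrow> real"
  assumes "bij_betw \<nu> {1..CARD('n)} UNIV"
    and "open D"
    and "smooth_on D F"
    and "minimal_graph_system D F"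
    and "p = (x, y)" and "p \<in> D \<times> UNIV"
    and "r = dim (range (frechet_derivative F (at x)))"
    and "nonzero_singular_values (frechet_derivative F (at x)) r lam"
  shows "comass CARD('n) (tsai_wang_form \<nu> F p) = 1 \<longleftrightarrow> S_sum r lam \<le> 1"
proof -
  let ?L = "frechet_derivative F (at x)"
  have "Ck_on (Suc 0) F D"
    using assms(3) by (simp only: smooth_on_def)
  then have "F differentiable (at x)"
    using assms(5,6) by simp
  then have L: "linear ?L"
    by (rule linear_frechet_derivative)
  obtain e f where svd: "is_svd ?L e f r lam"
    using assms(8) by (auto simp: nonzero_singular_values_def)
  obtain e' f' where "is_svd ?L e' f' r lam" "positively_oriented \<nu> e'"
    by (rule positively_oriented_svd_exists[OF svd L assms(1)])
  \<comment> \<open>Existence of adapted oriented coordinates makes the choice in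
    \<open>tsai_wang_form\<close> meaningful.\<close>
  then have "\<exists>\<omega> e f r lam. is_svd ?L e f r lam \<and> positively_oriented \<nu> e \<and>
      \<omega> = (tsai_wang_in_coords e f r lam :: ((real^'n) \<times> (real^'m)) list \<Rightarrow> real)"
    by blast
  from someI_ex[OF this]
  obtain e\<^sub>0 f\<^sub>0 r\<^sub>0 lam\<^sub>0 where svd\<^sub>0: "is_svd ?L e\<^sub>0 f\<^sub>0 r\<^sub>0 lam\<^sub>0"
    and \<omega>: "tsai_wang_form \<nu> F p = tsai_wang_in_coords e\<^sub>0 f\<^sub>0 r\<^sub>0 lam\<^sub>0"
    using assms(5) by (auto simp: tsai_wang_form_def)
  \<comment> \<open>The chosen decomposition may differ from the given one, but the sum does not
    depend on it.\<close>
  have "S_sum r lam = S_sum r\<^sub>0 lam\<^sub>0"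
    by (rule S_sum_svd_unique[OF svd svd\<^sub>0 L])
  then show ?thesis
    by (simp only: \<omega> comass_tsai_wang_in_coords[OF svd\<^sub>0])
qed

end
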